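(* Fix an integer $k\ge 4$ and suppose there exists a counterexample for $k$. If there exists a bad graph on $n$ vertices, then either $k=4$ and $n\le 12$, or $k\ge 5$ and $n\le 2k-2$.
   Context: Graphs are finite, simple, undirected; $P_H(k)$ is the number of proper $k$-colorings of $H$; the $2$-core of $H$ is obtained by repeatedly deleting vertices of degree at most one. A counterexample for $k$ is a connected graph $H$ with $\chi(H)=k$ such that either $P_H(k)>k!(k-1)^{|V(H)|-k}$, or $P_H(k)=k!(k-1)^{|V(H)|-k}$ and the $2$-core of $H$ is not a $k$-clique. Let $n_0$ be the minimum number of vertices of a counterexample for $k$. A graph $G$ is bad if it is a counterexample for $k$ with exactly $n_0$ vertices and no proper subgraph of $G$ is a counterexample for $k$. *)

theory Defs
  imports "Graph_Theory.Graph_Theory" "HOL-Library.FuncSet"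
begin

text \<open>
  A finite simple undirected graph is a \<^locale>\<open>pair_graph\<close>: every edge \<open>uv\<close> is represented by
  the two arcs \<open>(u, v)\<close> and \<open>(v, u)\<close>, so the degree of a vertex is its out-degree.
\<close>

definition proper_colorings :: "('a, 'b) pre_digraph \<Rightarrow> nat \<Rightarrow> ('a \<Rightarrow> nat) set" where
  "proper_colorings G k =
     {f \<in> verts G \<rightarrow>\<^sub>E {..<k}. \<forall>(u, v) \<in> arcs_ends G. f u \<noteq> f v}"

definition num_colorings :: "('a, 'b) pre_digraph \<Rightarrow> nat \<Rightarrow> nat" where
  "num_colorings G k = card (proper_colorings G k)"

definition chromatic_number :: "('a, 'b) pre_digraph \<Rightarrow> nat" where
  "chromatic_number G = (LEAST k. proper_colorings G k \<noteq> {})"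

inductive prune_step :: "('a, 'b) pre_digraph \<Rightarrow> ('a, 'b) pre_digraph \<Rightarrow> bool" where
  "v \<in> verts G \<Longrightarrow> out_degree G v \<le> 1 \<Longrightarrow> prune_step G (pre_digraph.del_vert G v)"

definition is_two_core :: "('a, 'b) pre_digraph \<Rightarrow> ('a, 'b) pre_digraph \<Rightarrow> bool" where
  "is_two_core G C \<longleftrightarrow> prune_step\<^sup>*\<^sup>* G C \<and> \<not> (\<exists>C'. prune_step C C')"

definition two_core :: "('a, 'b) pre_digraph \<Rightarrow> ('a, 'b) pre_digraph" where
  "two_core G = (THE C. is_two_core G C)"

lemma (in wf_digraph) prune_steps_induced:
  assumes "prune_step\<^sup>*\<^sup>* G X"
  shows "verts X \<subseteq> verts G \<and> X = G \<restriction> verts X"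
  using assms
proof induction
  case base
  show ?case by (auto simp: induce_subgraph_def intro!: pre_digraph.equality)
next
  case (step X Y)
  from step(2) obtain v where Y: "Y = pre_digraph.del_vert X v"
    by (auto elim: prune_step.cases)
  have arcs: "arcs X = {e \<in> arcs G. tail G e \<in> verts X \<and> head G e \<in> verts X}"
    and ends: "tail X = tail G" "head X = head G"
    using step(3) by (metis induce_subgraph_arcs, metis induce_subgraph_tail,
        metis induce_subgraph_head)
  have "Y = G \<restriction> verts Y"
    unfolding Y pre_digraph.del_vert_def induce_subgraph_def
    by (auto simp: arcs ends)
  moreover have "verts Y \<subseteq> verts G"
    using step(3) by (auto simp: Y pre_digraph.del_vert_def)
  ultimately show ?case by blast
qed

lemma (in fin_digraph) is_two_core_verts_subset:
  assumes C: "is_two_core G C" and X: "prune_step\<^sup>*\<^sup>* G X"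
  shows "verts C \<subseteq> verts X"
  using X
proof induction
  case base
  show ?case using C prune_steps_induced by (auto simp: is_two_core_def)
next
  case (step X Y)
  from step(2) obtain v where v: "v \<in> verts X" "out_degree X v \<le> 1"
    and Y: "Y = pre_digraph.del_vert X v"
    by (auto elim: prune_step.cases)
  have "v \<notin> verts C"
  proof
    assume "v \<in> verts C"
    have C': "C = G \<restriction> verts C" and X': "X = G \<restriction> verts X"
      using prune_steps_induced C step(1) by (auto simp: is_two_core_def)
    have "out_arcs (G \<restriction> verts C) v \<subseteq> out_arcs (G \<restriction> verts X) v"
      using step(3) by (auto simp: out_arcs_def)
    moreover have "finite (out_arcs (G \<restriction> verts X) v)"
      by (auto simp: out_arcs_def)
    ultimately have "out_degree C v \<le> out_degree X v"
      unfolding out_degree_def by (metis C' X' card_mono)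
    with v \<open>v \<in> verts C\<close> have "prune_step C (pre_digraph.del_vert C v)"
      by (intro prune_step.intros) auto
    then show False using C by (auto simp: is_two_core_def)
  qed
  then show ?case using step(3) by (auto simp: Y pre_digraph.del_vert_def)
qed

lemma (in fin_digraph) ex1_two_core: "\<exists>!C. is_two_core G C"
proof (rule ex_ex1I)
  have "\<exists>C. prune_step\<^sup>*\<^sup>* X C \<and> \<not> (\<exists>C'. prune_step C C')" if "finite (verts X)"
    for X :: "('a, 'b) pre_digraph"
    using that
  proof (induction "card (verts X)" arbitrary: X rule: less_induct)
    case less
    show ?case
    proof (cases "\<exists>Y. prune_step X Y")
      case True
      then obtain v where v: "v \<in> verts X" "prune_step X (pre_digraph.del_vert X v)"
        by (auto elim!: prune_step.cases intro: prune_step.intros)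
      have "card (verts (pre_digraph.del_vert X v)) < card (verts X)"
        using v(1) less.prems by (simp add: pre_digraph.del_vert_def card_Diff1_less del: card_Diff_insert card_Diff_singleton)
      moreover have "finite (verts (pre_digraph.del_vert X v))"
        using less.prems by (auto simp: pre_digraph.del_vert_def)
      ultimately show ?thesis
        using less.hyps v(2) by (meson converse_rtranclp_into_rtranclp)
    qed auto
  qed
  then show "\<exists>C. is_two_core G C" by (auto simp: is_two_core_def)
next
  fix C D assume "is_two_core G C" "is_two_core G D"
  then have "verts C = verts D" "C = G \<restriction> verts C" "D = G \<restriction> verts D"
    using is_two_core_verts_subset prune_steps_induced by (auto simp: is_two_core_def)
  then show "C = D" by simp
qed

text \<open>
  Since \<open>k\<close> equals the chromatic number, \<open>k\<close> is at most the number of vertices and the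
  exponent is not affected by truncated subtraction.
\<close>

definition counterexample :: "nat \<Rightarrow> 'a pair_pre_digraph \<Rightarrow> bool" where
  "counterexample k H \<longleftrightarrow>
     pair_graph H \<and> connected H \<and> chromatic_number H = k \<and>
     (num_colorings H k > fact k * (k - 1) ^ (card (pverts H) - k) \<or>
      num_colorings H k = fact k * (k - 1) ^ (card (pverts H) - k) \<and>
        \<not> complete_digraph k (two_core H))"

text \<open>
  Every finite graph is isomorphic to one whose vertices are natural numbers, so it suffices
  to minimise over those.
\<close>

definition min_counterexample_order :: "nat \<Rightarrow> nat" where
  "min_counterexample_order k =
     (LEAST n. \<exists>H :: nat pair_pre_digraph. counterexample k H \<and> card (pverts H) = n)"

definition bad :: "nat \<Rightarrow> 'a pair_pre_digraph \<Rightarrow> bool" where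
  "bad k G \<longleftrightarrow>
     counterexample k G \<and> card (pverts G) = min_counterexample_order k \<and>
     \<not> (\<exists>H :: 'a pair_pre_digraph. subgraph (with_proj H) (with_proj G) \<and> H \<noteq> G \<and> counterexample k H)"

end

theory Submission
  imports Defs "HOL-Combinatorics.Permutations"
begin

text \<open>
  Let \<open>P\<close> be the number of \<open>k\<close>-colourings of a bad graph and choose one of them, \<open>f\<close>, uniformly at
  random. Comparing with the greedy random colouring along a vertex order gives
  \<open>ln P \<le> \<Sum>v. E (ln a v)\<close>, where \<open>a v\<close> is the number of colours not used on earlier neighbours
  of \<open>v\<close>; average this over all orders. Since the chromatic number is \<open>k\<close>, every colour class of
  \<open>f\<close> contains a vertex seeing all other colours. These \<open>k\<close> vertices together contribute at most
  \<open>ln k!\<close>. Any other vertex has three neighbours; unless these are monochromatic it contributes at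
  most \<open>(ln k + 2 ln (k - 1) + ln (k - 2)) / 4 < ln (k - 1)\<close>. Identifying the three neighbours
  yields a smaller graph, so by minimality they are monochromatic with probability at most
  \<open>1 / (k - 1)\<^sup>2\<close>. As \<open>P \<ge> k! (k - 1) ^ (n - k)\<close>, this forces \<open>(n - k) (k - 2) \<le> n\<close>.
\<close>

section \<open>Colourings and random greedy orders\<close>

text \<open>The same colourings as in \<open>proper_colorings\<close>, but on bare vertex and arc
  sets, so that induced subgraphs and images under maps need no graph record.\<close>

definition colorings :: "'a set \<Rightarrow> ('a \<times> 'a) set \<Rightarrow> nat \<Rightarrow> ('a \<Rightarrow> nat) set" where
  "colorings V E k = {f \<in> V \<rightarrow>\<^sub>E {..<k}. \<forall>(u, v) \<in> E. f u \<noteq> f v}"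

lemma coloringsD:
  assumes "f \<in> colorings V E k"
  shows "f \<in> V \<rightarrow>\<^sub>E {..<k}" "v \<in> V \<Longrightarrow> f v < k" "(u, v) \<in> E \<Longrightarrow> f u \<noteq> f v"
  using assms by (auto simp: colorings_def PiE_def Pi_def)

lemma coloringsI:
  assumes "\<And>v. v \<in> V \<Longrightarrow> f v < k" "\<And>v. v \<notin> V \<Longrightarrow> f v = undefined"
    "\<And>u v. (u, v) \<in> E \<Longrightarrow> f u \<noteq> f v"
  shows "f \<in> colorings V E k"
  using assms by (auto simp: colorings_def PiE_iff extensional_def)

lemma finite_colorings: "finite V \<Longrightarrow> finite (colorings V E k)"
  unfolding colorings_def by (intro finite_Collect_conjI disjI1) (simp add: finite_PiE)

text \<open>The rank \<open>r\<close> encodes the vertex order; only strictly earlier neighbours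
  block a colour.\<close>

definition free_colors ::
  "'a set \<Rightarrow> ('a \<times> 'a) set \<Rightarrow> nat \<Rightarrow> ('a \<Rightarrow> nat) \<Rightarrow> ('a \<Rightarrow> nat) \<Rightarrow> 'a \<Rightarrow> nat set" where
  "free_colors V E k r f v = {..<k} - f ` {u \<in> V. (u, v) \<in> E \<and> r u < r v}"

lemma finite_free_colors [simp]: "finite (free_colors V E k r f v)"
  by (simp add: free_colors_def)

text \<open>The summand is the probability that greedily colouring the vertices in the order given by
  \<open>r\<close>, with a uniformly random free colour at each step, produces \<open>f\<close>.\<close>

lemma sum_greedy_weights_le_1:
  fixes r :: "'a \<Rightarrow> nat"
  assumes "finite V"
  shows "(\<Sum>f \<in> V \<rightarrow>\<^sub>E {..<k}. \<Prod>v\<in>V. if f v \<in> free_colors V E k r f v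
            then 1 / real (card (free_colors V E k r f v)) else 0) \<le> 1"
  using assms
proof (induction V rule: finite_ranking_induct[where f = r])
  case empty
  show ?case by simp
next
  case (insert x S)
  define w where "w S f v = (if f v \<in> free_colors S E k r f v
            then 1 / real (card (free_colors S E k r f v)) else 0)" for S :: "'a set" and f v
  have IH: "(\<Sum>f \<in> S \<rightarrow>\<^sub>E {..<k}. \<Prod>v\<in>S. w S f v) \<le> 1"
    using insert.IH by (simp add: w_def)
  show ?case
  proof (cases "x \<in> S")
    case True
    then show ?thesis using insert.IH by (simp only: insert_absorb)
  next
    case False
    \<comment> \<open>The new vertex \<open>x\<close> has maximal rank, so it is never strictly
      earlier than an old vertex; ties are harmless.\<close>
    have w_old: "w (insert x S) (g(x := c)) v = w S g v" if "v \<in> S" for g c v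
    proof -
      have "{u \<in> insert x S. (u, v) \<in> E \<and> r u < r v} = {u \<in> S. (u, v) \<in> E \<and> r u < r v}"
        using insert.hyps(2)[OF that] by auto
      moreover have "(g(x := c)) ` {u \<in> S. (u, v) \<in> E \<and> r u < r v}
          = g ` {u \<in> S. (u, v) \<in> E \<and> r u < r v}"
        using False by (intro image_cong) auto
      ultimately have "free_colors (insert x S) E k r (g(x := c)) v = free_colors S E k r g v"
        by (simp add: free_colors_def)
      then show ?thesis using that False by (auto simp: w_def)
    qed
    \<comment> \<open>The free colours of the last vertex depend on \<open>g\<close> alone. Its
      weights sum to 1, or to 0 if no colour is free, hence only an inequality.\<close>
    have w_new: "(\<Sum>c<k. w (insert x S) (g(x := c)) x) \<le> 1" for g
    proof -
      define A where "A = free_colors S E k r g x"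
      have eq: "free_colors (insert x S) E k r (g(x := c)) x = A" for c
      proof -
        have "(g(x := c)) ` {u \<in> insert x S. (u, x) \<in> E \<and> r u < r x}
           = g ` {u \<in> S. (u, x) \<in> E \<and> r u < r x}"
          using False by (intro image_cong) auto
        then show ?thesis by (simp add: free_colors_def A_def)
      qed
      have "(\<Sum>c<k. w (insert x S) (g(x := c)) x)
          = (\<Sum>c<k. if c \<in> A then 1 / real (card A) else 0)"
        by (simp only: w_def eq fun_upd_same)
      also have "\<dots> = (\<Sum>c\<in>{..<k} \<inter> A. 1 / real (card A))"
        by (rule sum.inter_restrict[symmetric]) simp
      also have "{..<k} \<inter> A = A" by (auto simp: A_def free_colors_def)
      also have "(\<Sum>c\<in>A. 1 / real (card A)) \<le> 1" by simp
      finally show ?thesis .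
    qed
    have "(\<Sum>f \<in> insert x S \<rightarrow>\<^sub>E {..<k}. \<Prod>v\<in>insert x S. w (insert x S) f v)
        = (\<Sum>(c, g) \<in> {..<k} \<times> (S \<rightarrow>\<^sub>E {..<k}). \<Prod>v\<in>insert x S. w (insert x S) (g(x := c)) v)"
      unfolding PiE_insert_eq
      by (subst sum.reindex) (use False in \<open>auto intro!: inj_combinator sum.cong simp: o_def\<close>)
    also have "\<dots> = (\<Sum>g \<in> S \<rightarrow>\<^sub>E {..<k}. \<Sum>c<k.
         w (insert x S) (g(x := c)) x * (\<Prod>v\<in>S. w S g v))"
      unfolding sum.cartesian_product[symmetric]
      by (subst sum.swap) (use False insert.hyps(1) in \<open>simp add: w_old\<close>)
    also have "\<dots> = (\<Sum>g \<in> S \<rightarrow>\<^sub>E {..<k}.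
         (\<Sum>c<k. w (insert x S) (g(x := c)) x) * (\<Prod>v\<in>S. w S g v))"
      by (simp add: sum_distrib_right)
    also have "\<dots> \<le> (\<Sum>g \<in> S \<rightarrow>\<^sub>E {..<k}. 1 * (\<Prod>v\<in>S. w S g v))"
      by (intro sum_mono mult_right_mono w_new prod_nonneg) (auto simp: w_def)
    also have "\<dots> \<le> 1" using IH by simp
    finally show ?thesis by (simp add: w_def)
  qed
qed

lemma coloring_in_free_colors:
  assumes "f \<in> colorings V E k" "v \<in> V"
  shows "f v \<in> free_colors V E k r f v"
  using coloringsD[OF assms(1)] assms(2) by (fastforce simp: free_colors_def)

lemma card_free_colors_pos:
  assumes "f \<in> colorings V E k" "v \<in> V"
  shows "card (free_colors V E k r f v) > 0"
  using coloring_in_free_colors[OF assms] by (auto simp: card_gt_0_iff)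

text \<open>This is Gibbs' inequality, comparing the uniform distribution on colourings with the
  greedy weights \<open>1 / a f\<close>. The latter sum to at most 1, so adding up
  \<open>ln x <= x - 1\<close> for \<open>x = P / a f\<close> gives the bound.\<close>

lemma num_colorings_ln_le:
  fixes V :: "'a set" and E k and r :: "'a \<Rightarrow> nat"
  assumes "finite V"
  defines "P \<equiv> real (card (colorings V E k))"
  shows "P * ln P \<le> (\<Sum>f\<in>colorings V E k. \<Sum>v\<in>V. ln (real (card (free_colors V E k r f v))))"
proof (cases "P = 0")
  case True
  then have "colorings V E k = {}"
    using finite_colorings[OF assms(1)] by (simp add: P_def)
  then show ?thesis by (simp add: True)
next
  case False
  let ?C = "colorings V E k"
  define a where "a f = (\<Prod>v\<in>V. real (card (free_colors V E k r f v)))" for f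
  have P: "P > 0" using False by (simp add: P_def)
  have a: "a f > 0" if "f \<in> ?C" for f
    unfolding a_def using card_free_colors_pos[OF that] by (auto intro!: prod_pos)
  have "(\<Sum>f\<in>?C. 1 / a f) = (\<Sum>f\<in>?C. \<Prod>v\<in>V. if f v \<in> free_colors V E k r f v
            then 1 / real (card (free_colors V E k r f v)) else 0)"
    by (rule sum.cong) (auto simp: a_def coloring_in_free_colors prod_dividef intro!: prod.cong)
  also have "\<dots> \<le> (\<Sum>f \<in> V \<rightarrow>\<^sub>E {..<k}. \<Prod>v\<in>V. if f v \<in> free_colors V E k r f v
            then 1 / real (card (free_colors V E k r f v)) else 0)"
  proof (rule sum_mono2)
    show "finite (V \<rightarrow>\<^sub>E {..<k})" using assms(1) by (simp add: finite_PiE)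
    show "?C \<subseteq> V \<rightarrow>\<^sub>E {..<k}" by (auto simp: colorings_def)
  qed (intro prod_nonneg, simp)
  also have "\<dots> \<le> 1" by (rule sum_greedy_weights_le_1[OF assms(1)])
  finally have le1: "(\<Sum>f\<in>?C. 1 / a f) \<le> 1" .
  have "(\<Sum>f\<in>?C. ln (P / a f)) \<le> (\<Sum>f\<in>?C. P / a f - 1)"
    using a P by (intro sum_mono ln_le_minus_one) auto
  also have "\<dots> = P * (\<Sum>f\<in>?C. 1 / a f) - P"
    by (simp add: sum_subtractf sum_distrib_left P_def)
  also have "\<dots> \<le> 0" using le1 P by (simp add: mult_le_cancel_left2)
  finally have "(\<Sum>f\<in>?C. ln (P / a f)) \<le> 0" .
  moreover have "ln (P / a f) = ln P - ln (a f)" if "f \<in> ?C" for f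
    using a[OF that] P by (simp add: ln_div)
  ultimately have "(\<Sum>f\<in>?C. ln P - ln (a f)) \<le> 0" by simp
  then have "P * ln P \<le> (\<Sum>f\<in>?C. ln (a f))"
    by (simp add: sum_subtractf P_def)
  also have "\<dots> = (\<Sum>f\<in>?C. \<Sum>v\<in>V. ln (real (card (free_colors V E k r f v))))"
    unfolding a_def
    using card_free_colors_pos[THEN less_imp_neq]
    by (intro sum.cong refl ln_prod) (use assms in \<open>force+\<close>)
  finally show ?thesis .
qed

section \<open>Ranks in a uniformly random order\<close>

lemma bij_betw_rank:
  fixes r :: "'a \<Rightarrow> nat"
  assumes "finite T" "inj_on r T"
  shows "bij_betw (\<lambda>t. card {u \<in> T. r u < r t}) T {..<card T}"
proof -
  have mono: "card {u \<in> T. r u < r s} < card {u \<in> T. r u < r t}"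
    if "s \<in> T" "t \<in> T" "r s < r t" for s t
    using that assms(1) by (intro psubset_card_mono) auto
  have inj: "inj_on (\<lambda>t. card {u \<in> T. r u < r t}) T"
  proof (rule inj_onI, rule ccontr)
    fix s t assume st: "s \<in> T" "t \<in> T" "s \<noteq> t"
      and eq: "card {u \<in> T. r u < r s} = card {u \<in> T. r u < r t}"
    from st have "r s \<noteq> r t" using assms(2) by (auto dest: inj_onD)
    then show False using mono[of s t] mono[of t s] st eq by linarith
  qed
  moreover have "(\<lambda>t. card {u \<in> T. r u < r t}) ` T \<subseteq> {..<card T}"
    using assms(1) by (auto intro!: psubset_card_mono)
  ultimately show ?thesis
    by (simp add: bij_betw_def card_image card_subset_eq)
qed

text \<open>In a random order, \<open>v\<close> is equally likely to take each position within
  \<open>insert v S\<close>. Precomposing with a transposition shows that all elements of this set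
  have the same distribution of ranks, and for a fixed permutation their ranks run once through
  \<open>0, ..., card S\<close>.\<close>

lemma sum_permutations_rank:
  fixes V :: "'a set" and F :: "nat \<Rightarrow> real" and e :: "'a \<Rightarrow> nat"
  assumes V: "finite V" "inj_on e V" and S: "S \<subseteq> V" "v \<in> V" "v \<notin> S"
  defines "Q \<equiv> {p. p permutes V}"
  shows "(\<Sum>p\<in>Q. F (card {u \<in> S. e (p u) < e (p v)}))
     = real (card Q) * (\<Sum>j\<le>card S. F j) / real (card S + 1)"
proof -
  define T where "T = insert v S"
  have fT: "finite T" "T \<subseteq> V" and cT: "card T = card S + 1"
    using S V(1) by (auto simp: T_def finite_subset[OF S(1) V(1)])
  define R where "R p t = card {u \<in> T. e (p u) < e (p t)}" for p t
  have R_v: "R p v = card {u \<in> S. e (p u) < e (p v)}" for p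
    unfolding R_def T_def by (rule arg_cong[where f = card]) auto
  have sym: "(\<Sum>p\<in>Q. F (R p t)) = (\<Sum>p\<in>Q. F (R p v))" if t: "t \<in> T" for t
  proof -
    let ?\<tau> = "transpose v t"
    have tau: "?\<tau> permutes V" "?\<tau> permutes T"
      using t fT S by (auto intro!: permutes_swap_id simp: T_def)
    have "R (p \<circ> ?\<tau>) t = R p v" for p
    proof -
      have "{u \<in> T. e (p u) < e (p v)} = ?\<tau> ` {u \<in> T. e (p (?\<tau> u)) < e (p v)}"
        using permutes_in_image[OF tau(2)]
        by (auto simp: image_iff) (metis transpose_involutory)
      then have "card {u \<in> T. e (p u) < e (p v)} = card {u \<in> T. e (p (?\<tau> u)) < e (p v)}"
        by (simp only: card_image[OF inj_on_subset[OF permutes_inj[OF tau(1)] subset_UNIV]])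
      then show ?thesis by (simp add: R_def)
    qed
    moreover have "bij_betw (\<lambda>p. p \<circ> ?\<tau>) Q Q"
      unfolding Q_def
      by (rule bij_betw_byWitness[where f' = "\<lambda>p. p \<circ> ?\<tau>"])
         (auto simp: fun_eq_iff intro: permutes_compose[OF tau(1)])
    ultimately show ?thesis
      using sum.reindex_bij_betw[of "\<lambda>p. p \<circ> ?\<tau>" Q Q "\<lambda>p. F (R p t)"] by simp
  qed
  have rank: "(\<Sum>t\<in>T. F (R p t)) = (\<Sum>j\<le>card S. F j)" if "p \<in> Q" for p
  proof -
    have "inj_on (e \<circ> p) T"
      using that V(2) fT(2) permutes_inj[of p V] permutes_image[of p V]
      by (intro comp_inj_on) (auto simp: Q_def intro: inj_on_subset)
    from sum.reindex_bij_betw[OF bij_betw_rank[OF fT(1) this], of F]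
    show ?thesis by (simp add: R_def cT lessThan_Suc_atMost)
  qed
  have "real (card T) * (\<Sum>p\<in>Q. F (R p v)) = (\<Sum>t\<in>T. \<Sum>p\<in>Q. F (R p t))"
    by (simp add: sym)
  also have "\<dots> = (\<Sum>p\<in>Q. \<Sum>t\<in>T. F (R p t))" by (rule sum.swap)
  also have "\<dots> = real (card Q) * (\<Sum>j\<le>card S. F j)" by (simp add: rank)
  finally show ?thesis by (simp add: R_v cT field_simps)
qed

section \<open>Vertices that see all other colours\<close>

text \<open>Otherwise every vertex of colour \<open>c\<close> misses some other colour and can be
  moved to it. This empties the class \<open>c\<close> and leaves a colouring with
  \<open>k - 1\<close> colours.\<close>

lemma colorful_vertex:
  assumes f: "f \<in> colorings V E k" and none: "colorings V E (k - 1) = {}"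
    and E: "E \<subseteq> V \<times> V" "sym E" and c: "c < k"
  obtains v where "v \<in> V" "f v = c" "\<And>d. d < k \<Longrightarrow> d \<noteq> c \<Longrightarrow> \<exists>u. (u, v) \<in> E \<and> f u = d"
proof (rule ccontr)
  assume "\<not> thesis"
  then have "\<forall>v. \<exists>d. v \<in> V \<and> f v = c \<longrightarrow> d < k \<and> d \<noteq> c \<and> (\<forall>u. (u, v) \<in> E \<longrightarrow> f u \<noteq> d)"
    using that by blast
  then obtain d where d: "\<And>v. v \<in> V \<Longrightarrow> f v = c \<Longrightarrow> d v < k \<and> d v \<noteq> c"
      "\<And>u v. v \<in> V \<Longrightarrow> f v = c \<Longrightarrow> (u, v) \<in> E \<Longrightarrow> f u \<noteq> d v"
    by metis
  \<comment> \<open>A colour class is independent, so all its vertices can be recoloured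
    simultaneously.\<close>
  define g where "g v = (if f v = c then d v else f v)" for v
  \<comment> \<open>Colour \<open>c\<close> is now vacant, and colour \<open>k - 1\<close> takes its
    place.\<close>
  define h where "h x = (if x = k - 1 then c else x)" for x
  have g: "g v < k" "g v \<noteq> c" if "v \<in> V" for v
    using d(1)[OF that] coloringsD(2)[OF f that] by (auto simp: g_def)
  have g_proper: "g u \<noteq> g v" if "(u, v) \<in> E" for u v
  proof -
    have uv: "u \<in> V" "v \<in> V" "(v, u) \<in> E" using that E by (auto dest: symD)
    show ?thesis
      using coloringsD(3)[OF f that] d(2)[OF uv(1) _ uv(3)] d(2)[OF uv(2) _ that]
      by (auto simp: g_def split: if_splits)
  qed
  have h_inj: "h x \<noteq> h y" if "x \<noteq> y" "x \<noteq> c" "y \<noteq> c" for x y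
    using that by (auto simp: h_def split: if_splits)
  have h_less: "h x < k - 1" if "x < k" "x \<noteq> c" for x
    using that c by (auto simp: h_def)
  have "restrict (h \<circ> g) V \<in> colorings V E (k - 1)"
    unfolding colorings_def
  proof (intro CollectI conjI ballI)
    show "restrict (h \<circ> g) V \<in> V \<rightarrow>\<^sub>E {..<k - 1}"
      using g h_less by (auto simp: PiE_iff)
  next
    fix x assume x: "x \<in> E"
    obtain u v where uv: "x = (u, v)" by (cases x)
    then have "u \<in> V" "v \<in> V" using x E(1) by auto
    then show "case x of (u, v) \<Rightarrow> restrict (h \<circ> g) V u \<noteq> restrict (h \<circ> g) V v"
      using h_inj[OF g_proper g(2) g(2)] x uv by auto
  qed
  with none show False by blast
qed

text \<open>\<open>F\<close> takes one such vertex from each colour class, and \<open>S\<close> one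
  of its neighbours in each of the other \<open>k - 1\<close> colours.\<close>

lemma colorful_transversal:
  assumes f: "f \<in> colorings V E k" and none: "colorings V E (k - 1) = {}"
    and E: "E \<subseteq> V \<times> V" "sym E"
  obtains F where "F \<subseteq> V" "card F = k"
    "\<And>v. v \<in> F \<Longrightarrow> \<exists>S\<subseteq>V. card S = k - 1 \<and> inj_on f S \<and> (\<forall>u\<in>S. (u, v) \<in> E)"
proof -
  have "\<forall>c. \<exists>v. c < k \<longrightarrow> v \<in> V \<and> f v = c \<and> (\<forall>d<k. d \<noteq> c \<longrightarrow> (\<exists>u. (u, v) \<in> E \<and> f u = d))"
    using colorful_vertex[OF assms] by metis
  then obtain w where w: "\<And>c. c < k \<Longrightarrow> w c \<in> V" "\<And>c. c < k \<Longrightarrow> f (w c) = c"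
      "\<And>c d. c < k \<Longrightarrow> d < k \<Longrightarrow> d \<noteq> c \<Longrightarrow> \<exists>u. (u, w c) \<in> E \<and> f u = d"
    by metis
  show thesis
  proof
    show "w ` {..<k} \<subseteq> V" using w(1) by auto
    have "inj_on w {..<k}" by (rule inj_on_inverseI[where g = f]) (simp add: w(2))
    then show "card (w ` {..<k}) = k" by (simp add: card_image)
    fix v assume "v \<in> w ` {..<k}"
    then obtain c where c: "c < k" "v = w c" by auto
    then obtain u where u: "\<And>d. d < k \<Longrightarrow> d \<noteq> c \<Longrightarrow> (u d, v) \<in> E \<and> f (u d) = d"
      using w(3)[of c] by metis
    have inj: "inj_on u ({..<k} - {c})"
      by (rule inj_on_inverseI[where g = f]) (simp add: u)
    then have "card (u ` ({..<k} - {c})) = k - 1" using c(1) by (simp add: card_image)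
    moreover have "inj_on f (u ` ({..<k} - {c}))"
      by (rule inj_on_inverseI[where g = u]) (auto, metis u)
    ultimately show "\<exists>S\<subseteq>V. card S = k - 1 \<and> inj_on f S \<and> (\<forall>u\<in>S. (u, v) \<in> E)"
      using u E(1) by (intro exI[of _ "u ` ({..<k} - {c})"]) auto
  qed
qed

section \<open>Average logarithm of the number of free colours\<close>

lemma card_free_colors_le:
  assumes f: "f \<in> colorings V E k" and S: "S \<subseteq> V" "\<forall>u\<in>S. (u, v) \<in> E"
  shows "card (free_colors V E k r f v) \<le> k - card (f ` {u \<in> S. r u < r v})"
proof -
  let ?A = "f ` {u \<in> S. r u < r v}"
  have sub: "?A \<subseteq> {..<k}" using coloringsD(2)[OF f] S(1) by auto
  have "card (free_colors V E k r f v) \<le> card ({..<k} - ?A)"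
    unfolding free_colors_def using S by (intro card_mono) auto
  also have "\<dots> = k - card ?A"
    using sub by (subst card_Diff_subset) (auto intro: finite_subset)
  finally show ?thesis .
qed

lemma sum_ln_eq_ln_fact: "(\<Sum>j<k. ln (real (k - j))) = ln (fact k)"
proof (induction k)
  case (Suc k)
  have "(\<Sum>j<Suc k. ln (real (Suc k - j))) = ln (real (Suc k)) + (\<Sum>j<k. ln (real (k - j)))"
    by (subst sum.lessThan_Suc_shift) simp
  also have "\<dots> = ln (real (Suc k) * fact k)"
    unfolding Suc.IH by (subst ln_mult_pos) simp_all
  finally show ?case by simp
qed simp

text \<open>If \<open>j\<close> of the differently coloured neighbours precede \<open>v\<close>, at
  most \<open>k - j\<close> colours are free. As \<open>j\<close> is uniform on
  \<open>0, ..., k - 1\<close>, the average is at most the mean of \<open>ln (k - j)\<close>, which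
  is \<open>ln (fact k) / k\<close>.\<close>

lemma avg_ln_free_colors_rainbow:
  fixes e :: "'a \<Rightarrow> nat"
  assumes V: "finite V" "inj_on e V" and f: "f \<in> colorings V E k"
    and S: "S \<subseteq> V" "v \<in> V" "v \<notin> S" "\<forall>u\<in>S. (u, v) \<in> E"
    and rainbow: "card S = k - 1" "inj_on f S" and k: "k > 0"
  shows "(\<Sum>p | p permutes V. ln (real (card (free_colors V E k (e \<circ> p) f v))))
      \<le> real (card {p. p permutes V}) * (ln (fact k) / real k)"
proof -
  have "(\<Sum>p | p permutes V. ln (real (card (free_colors V E k (e \<circ> p) f v))))
     \<le> (\<Sum>p | p permutes V. ln (real (k - card {u \<in> S. e (p u) < e (p v)})))"
  proof (rule sum_mono)
    fix p
    have "card (f ` {u \<in> S. (e \<circ> p) u < (e \<circ> p) v}) = card {u \<in> S. e (p u) < e (p v)}"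
      using rainbow(2) by (subst card_image) (auto intro: inj_on_subset)
    with card_free_colors_le[OF f S(1,4), of "e \<circ> p"]
    have "card (free_colors V E k (e \<circ> p) f v) \<le> k - card {u \<in> S. e (p u) < e (p v)}" by simp
    with card_free_colors_pos[OF f S(2), of "e \<circ> p"]
    show "ln (real (card (free_colors V E k (e \<circ> p) f v)))
        \<le> ln (real (k - card {u \<in> S. e (p u) < e (p v)}))"
      by (intro ln_mono) linarith+
  qed
  also have "\<dots> = real (card {p. p permutes V}) * (\<Sum>j\<le>k - 1. ln (real (k - j))) / real k"
    using sum_permutations_rank[OF V S(1-3), of "\<lambda>j. ln (real (k - j))"] rainbow(1) k by simp
  also have "{..k - 1} = {..<k}" using k by auto
  finally show ?thesis by (simp only: sum_ln_eq_ln_fact times_divide_eq_right)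
qed

text \<open>The number of triple members preceding \<open>v\<close> is uniform on
  \<open>0, ..., 3\<close>, which explains the denominator 4 and the four logarithms.\<close>

lemma avg_ln_free_colors_triple:
  fixes e :: "'a \<Rightarrow> nat"
  assumes V: "finite V" "inj_on e V" and f: "f \<in> colorings V E k"
    and S: "S \<subseteq> V" "v \<in> V" "v \<notin> S" "\<forall>u\<in>S. (u, v) \<in> E"
    and "card S = 3" and k: "k \<ge> 4"
  shows "(\<Sum>p | p permutes V. ln (real (card (free_colors V E k (e \<circ> p) f v))))
      \<le> real (card {p. p permutes V}) * ((ln (real k) + 2 * ln (real (k - 1)) +
           ln (if card (f ` S) = 1 then real (k - 1) else real (k - 2))) / 4)"
proof -
  have finS: "finite S" using S(1) V(1) by (rule finite_subset)
  define b where "b = (if card (f ` S) = 1 then k - 1 else k - 2)"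
  \<comment> \<open>Two earlier neighbours may share a colour, so one or two of them are only
    credited with blocking a single colour; the colour pattern matters only when all three are
    earlier.\<close>
  define F where "F j = (if j = 0 then k else if j = 3 then b else k - 1)" for j :: nat
  have "(\<Sum>p | p permutes V. ln (real (card (free_colors V E k (e \<circ> p) f v))))
     \<le> (\<Sum>p | p permutes V. ln (real (F (card {u \<in> S. e (p u) < e (p v)}))))"
  proof (rule sum_mono)
    fix p
    let ?T = "{u \<in> S. e (p u) < e (p v)}"
    have le: "card (free_colors V E k (e \<circ> p) f v) \<le> k - card (f ` ?T)"
      using card_free_colors_le[OF f S(1,4), of "e \<circ> p"] by simp
    have "k - card (f ` ?T) \<le> F (card ?T)"
    proof (cases "card ?T = 0")
      case False
      then have "card (f ` ?T) \<noteq> 0" using finS by auto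
      show ?thesis
      proof (cases "card ?T = 3")
        case True
        then have "?T = S" using finS \<open>card S = 3\<close> by (intro card_subset_eq) auto
        then have "card (f ` ?T) = card (f ` S)" by (rule arg_cong)
        with True \<open>card (f ` ?T) \<noteq> 0\<close> show ?thesis
          unfolding F_def b_def by (simp del: card_eq_0_iff card_0_eq) linarith
      qed (use False \<open>card (f ` ?T) \<noteq> 0\<close> in \<open>auto simp: F_def\<close>)
    qed (simp add: F_def)
    with le card_free_colors_pos[OF f S(2), of "e \<circ> p"]
    show "ln (real (card (free_colors V E k (e \<circ> p) f v))) \<le> ln (real (F (card ?T)))"
      by (intro ln_mono) linarith+
  qed
  also have "\<dots> = real (card {p. p permutes V}) * (\<Sum>j\<le>3. ln (real (F j))) / 4"
    using sum_permutations_rank[OF V S(1-3), of "\<lambda>j. ln (real (F j))"] \<open>card S = 3\<close> by simp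
  also have "(\<Sum>j\<le>3. ln (real (F j))) = ln (real k) + 2 * ln (real (k - 1)) + ln (real b)"
    by (simp add: F_def numeral_3_eq_3)
  also have "real b = (if card (f ` S) = 1 then real (k - 1) else real (k - 2))"
    by (simp add: b_def)
  finally show ?thesis by (simp only: times_divide_eq_right)
qed

section \<open>The entropy count\<close>

text \<open>With \<open>x = k - 1\<close>, both bounds are \<open>ln y <= y - 1\<close>, for
  \<open>y = (x + 1) * (x - 1) / x ^ 2\<close> and \<open>y = x / (x - 1)\<close>. The first
  measures the gain from concavity of \<open>ln\<close>, the second the loss from a monochromatic
  triple.\<close>

lemma ln_consecutive_bounds:
  fixes k :: nat
  assumes "k \<ge> 3"
  shows "2 * ln (real (k - 1)) - ln (real k) - ln (real (k - 2)) \<ge> 1 / real (k - 1) ^ 2"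
    and "ln (real (k - 1)) - ln (real (k - 2)) \<le> 1 / real (k - 2)"
proof -
  define x where "x = real (k - 1)"
  have x: "x \<ge> 2" "real k = x + 1" "real (k - 2) = x - 1" using assms by (auto simp: x_def)
  have "ln ((x + 1) * (x - 1) / x ^ 2) \<le> (x + 1) * (x - 1) / x ^ 2 - 1"
    using x by (intro ln_le_minus_one) auto
  also have "\<dots> = - 1 / x ^ 2" using x(1) by (simp add: field_simps power2_eq_square)
  also have "ln ((x + 1) * (x - 1) / x ^ 2) = ln (x + 1) + ln (x - 1) - 2 * ln x"
    using x(1) by (simp add: ln_div ln_mult ln_realpow)
  finally show "2 * ln (real (k - 1)) - ln (real k) - ln (real (k - 2)) \<ge> 1 / real (k - 1) ^ 2"
    using x(2,3) unfolding x_def[symmetric] by simp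
  have "ln (x / (x - 1)) \<le> x / (x - 1) - 1" using x by (intro ln_le_minus_one) auto
  also have "\<dots> = 1 / (x - 1)" using x(1) by (simp add: field_simps)
  also have "ln (x / (x - 1)) = ln x - ln (x - 1)" using x(1) by (simp add: ln_div)
  finally show "ln (real (k - 1)) - ln (real (k - 2)) \<le> 1 / real (k - 2)"
    using x(2,3) unfolding x_def[symmetric] by simp
qed

text \<open>Summing the entropy bound over all vertex orders charges each vertex its average over
  random orders. For each colouring separately, \<open>k\<close> vertices are charged as members of
  a transversal and the others through their triples; the total is compared with the logarithm of
  the assumed lower bound.\<close>

lemma few_vertices_if_many_colorings:
  fixes V :: "'a set" and E :: "('a \<times> 'a) set" and k :: nat and N :: "'a \<Rightarrow> 'a set"
  defines "C \<equiv> colorings V E k" and "n \<equiv> card V"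
  assumes V: "finite V" and E: "E \<subseteq> V \<times> V" "sym E" "irrefl E" and k: "k \<ge> 4"
    and none: "colorings V E (k - 1) = {}"
    and many: "card C \<ge> fact k * (k - 1) ^ (n - k)"
    and N: "\<And>v. v \<in> V \<Longrightarrow> N v \<subseteq> V \<and> card (N v) = 3 \<and> (\<forall>u\<in>N v. (u, v) \<in> E)"
    and mono: "\<And>v. v \<in> V \<Longrightarrow> card {f \<in> C. card (f ` N v) = 1} * (k - 1) ^ 2 \<le> card C"
  shows "(n - k) * (k - 2) \<le> n"
proof -
  define P where "P = real (card C)"
  \<comment> \<open>A vertex outside the transversal is charged at most
    \<open>L - \<delta> / 4\<close>, and \<open>B / 4\<close> more if its triple is
    monochromatic.\<close>
  define L where "L = ln (real (k - 1))"
  define B where "B = ln (real (k - 1)) - ln (real (k - 2))"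
  define \<delta> where "\<delta> = 2 * ln (real (k - 1)) - ln (real k) - ln (real (k - 2))"
  define Q where "Q = {p. p permutes V}"
  define q where "q = real (card Q)"
  have finC: "finite C" using finite_colorings[OF V] by (simp add: C_def)
  have "fact k * (k - 1) ^ (n - k) > 0" using k by simp
  then have cC: "card C > 0" using many by linarith
  then have P: "P > 0" by (simp add: P_def)
  have B0: "B \<ge> 0" unfolding B_def using k by simp
  obtain e :: "'a \<Rightarrow> nat" where e: "inj_on e V"
    using finite_imp_inj_to_nat_seg[OF V] by auto
  have "finite Q" "id \<in> Q" unfolding Q_def using finite_permutations[OF V] by (auto simp: permutes_id)
  then have q: "q > 0" by (auto simp: q_def card_gt_0_iff)
  have vN: "v \<notin> N v" if "v \<in> V" for v
    using N[OF that] E(3) by (auto simp: irrefl_def)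
  have kn: "k \<le> n"
  proof -
    obtain f where "f \<in> C" using cC by (auto simp: card_gt_0_iff)
    then obtain F where "F \<subseteq> V" "card F = k"
      using colorful_transversal[OF _ none E(1,2)] unfolding C_def by metis
    then show ?thesis unfolding n_def using card_mono[OF V] by metis
  qed
  have per_f: "(\<Sum>v\<in>V. \<Sum>p\<in>Q. ln (real (card (free_colors V E k (e \<circ> p) f v))))
      \<le> q * (ln (fact k) + real (n - k) * (L - \<delta> / 4)
             + B / 4 * (\<Sum>v\<in>V. if card (f ` N v) = 1 then 1 else 0))" if "f \<in> C" for f
  proof -
    have f: "f \<in> colorings V E k" using that by (simp add: C_def)
    obtain F where F: "F \<subseteq> V" "card F = k"
      and rb: "\<And>v. v \<in> F \<Longrightarrow> \<exists>S\<subseteq>V. card S = k - 1 \<and> inj_on f S \<and> (\<forall>u\<in>S. (u, v) \<in> E)"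
      using colorful_transversal[OF f none E(1,2)] by blast
    define X where "X v = (\<Sum>p\<in>Q. ln (real (card (free_colors V E k (e \<circ> p) f v))))" for v
    define m :: "'a \<Rightarrow> real" where "m v = (if card (f ` N v) = 1 then 1 else 0)" for v
    \<comment> \<open>The \<open>k\<close> transversal vertices together cost
      \<open>ln (fact k)\<close>, matching the factor \<open>fact k\<close> in the assumed number of
      colourings.\<close>
    have "X v \<le> q * (ln (fact k) / real k)" if v: "v \<in> F" for v
    proof -
      obtain S where S: "S \<subseteq> V" "card S = k - 1" "inj_on f S" "\<forall>u\<in>S. (u, v) \<in> E"
        using rb[OF v] by blast
      have "v \<notin> S" using S(4) E(3) by (auto simp: irrefl_def)
      then show ?thesis unfolding X_def Q_def q_def
        using S v F(1) k by (intro avg_ln_free_colors_rainbow[OF V e f S(1)]) auto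
    qed
    then have "sum X F \<le> (\<Sum>v\<in>F. q * (ln (fact k) / real k))" by (rule sum_mono)
    also have "\<dots> = q * ln (fact k)" using F(2) k by simp
    finally have XF: "sum X F \<le> q * ln (fact k)" .
    have Xv: "X v \<le> q * (L - \<delta> / 4 + B / 4 * m v)" if v: "v \<in> V" for v
    proof -
      have "X v \<le> q * ((ln (real k) + 2 * ln (real (k - 1)) +
           ln (if card (f ` N v) = 1 then real (k - 1) else real (k - 2))) / 4)"
        unfolding X_def Q_def q_def
        using N[OF v] vN[OF v] v k by (intro avg_ln_free_colors_triple[OF V e f]) auto
      also have "(ln (real k) + 2 * ln (real (k - 1)) +
           ln (if card (f ` N v) = 1 then real (k - 1) else real (k - 2))) / 4
           = L - \<delta> / 4 + B / 4 * m v"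
        by (simp add: L_def \<delta>_def B_def m_def field_simps)
      finally show ?thesis .
    qed
    have "sum X (V - F) \<le> (\<Sum>v\<in>V - F. q * (L - \<delta> / 4 + B / 4 * m v))"
      by (rule sum_mono) (use Xv in auto)
    also have "\<dots> = q * (real (card (V - F)) * (L - \<delta> / 4) + B / 4 * sum m (V - F))"
      by (simp add: sum.distrib sum_distrib_left distrib_left)
    also have "card (V - F) = n - k"
      using F V by (simp add: card_Diff_subset n_def finite_subset)
    \<comment> \<open>The transversal depends on \<open>f\<close>, so monochromatic triples are
      counted at all vertices before averaging over \<open>f\<close>; this puts \<open>n\<close>
      instead of \<open>n - k\<close> on the right of the final bound.\<close>
    also have "sum m (V - F) \<le> sum m V"
      using V by (intro sum_mono2) (auto simp: m_def)
    finally have XVF: "sum X (V - F) \<le> q * (real (n - k) * (L - \<delta> / 4) + B / 4 * sum m V)"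
      using q B0 by (simp add: mult_left_mono)
    have "sum X V = sum X (V - F) + sum X F" by (rule sum.subset_diff[OF F(1) V])
    also have "\<dots> \<le> q * (ln (fact k) + real (n - k) * (L - \<delta> / 4) + B / 4 * sum m V)"
      using XF XVF by (simp add: distrib_left)
    finally show ?thesis by (simp add: X_def m_def)
  qed
  have mono_sum: "(\<Sum>f\<in>C. \<Sum>v\<in>V. if card (f ` N v) = 1 then 1 else 0)
      \<le> real n * (P / real (k - 1) ^ 2)"
  proof -
    have "(\<Sum>f\<in>C. \<Sum>v\<in>V. if card (f ` N v) = 1 then 1 else (0 :: real))
        = (\<Sum>v\<in>V. real (card {f \<in> C. card (f ` N v) = 1}))"
      by (subst sum.swap) (simp add: sum.If_cases finC Int_def)
    also have "\<dots> \<le> (\<Sum>v\<in>V. P / real (k - 1) ^ 2)"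
    proof (rule sum_mono)
      fix v assume "v \<in> V"
      from mono[OF this] have "real (card {f \<in> C. card (f ` N v) = 1} * (k - 1) ^ 2) \<le> P"
        unfolding P_def by (simp only: of_nat_le_iff)
      then show "real (card {f \<in> C. card (f ` N v) = 1}) \<le> P / real (k - 1) ^ 2"
        using k by (simp add: pos_le_divide_eq)
    qed
    finally show ?thesis by (simp add: n_def)
  qed
  have "q * (P * ln P) = (\<Sum>p\<in>Q. P * ln P)" by (simp add: q_def)
  also have "\<dots> \<le> (\<Sum>p\<in>Q. \<Sum>f\<in>C. \<Sum>v\<in>V. ln (real (card (free_colors V E k (e \<circ> p) f v))))"
    unfolding P_def C_def by (intro sum_mono num_colorings_ln_le[OF V])
  also have "\<dots> = (\<Sum>f\<in>C. \<Sum>v\<in>V. \<Sum>p\<in>Q. ln (real (card (free_colors V E k (e \<circ> p) f v))))"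
    by (subst sum.swap, rule sum.cong[OF refl], rule sum.swap)
  also have "\<dots> \<le> (\<Sum>f\<in>C. q * (ln (fact k) + real (n - k) * (L - \<delta> / 4)
             + B / 4 * (\<Sum>v\<in>V. if card (f ` N v) = 1 then 1 else 0)))"
    by (rule sum_mono[OF per_f])
  also have "\<dots> = q * (P * (ln (fact k) + real (n - k) * (L - \<delta> / 4))
        + B / 4 * (\<Sum>f\<in>C. \<Sum>v\<in>V. if card (f ` N v) = 1 then 1 else 0))"
    by (simp only: sum_distrib_left[symmetric] sum.distrib sum_constant P_def)
      (simp only: algebra_simps)
  also have "\<dots> \<le> q * (P * (ln (fact k) + real (n - k) * (L - \<delta> / 4))
        + B / 4 * (real n * (P / real (k - 1) ^ 2)))"
    using q B0 mono_sum by (intro mult_left_mono add_left_mono) auto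
  also have "\<dots> = q * (P * (ln (fact k) + real (n - k) * (L - \<delta> / 4)
        + B / 4 * (real n / real (k - 1) ^ 2)))"
    by (simp add: algebra_simps)
  finally have upper: "ln P \<le> ln (fact k) + real (n - k) * (L - \<delta> / 4)
        + B / 4 * (real n / real (k - 1) ^ 2)"
    using q P by (simp add: mult_le_cancel_left_pos)
  \<comment> \<open>The terms \<open>ln (fact k)\<close> and \<open>(n - k) * L\<close> occur in
    both bounds on \<open>ln P\<close> and cancel, leaving the gain from \<open>\<delta>\<close>
    against the loss from \<open>B\<close>.\<close>
  have "real (fact k * (k - 1) ^ (n - k)) \<le> P" unfolding P_def using many by (simp only: of_nat_le_iff)
  then have "ln (fact k * real (k - 1) ^ (n - k)) \<le> ln P"
    using k by (intro ln_mono) auto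
  moreover have "ln (fact k * real (k - 1) ^ (n - k)) = ln (fact k) + real (n - k) * L"
    using k by (simp add: ln_mult ln_realpow L_def)
  ultimately have "real (n - k) * \<delta> \<le> B * (real n / real (k - 1) ^ 2)"
    using upper by (simp add: algebra_simps)
  moreover have "real (n - k) * (1 / real (k - 1) ^ 2) \<le> real (n - k) * \<delta>"
    unfolding \<delta>_def using k by (intro mult_left_mono ln_consecutive_bounds) auto
  moreover have "B * (real n / real (k - 1) ^ 2) \<le> 1 / real (k - 2) * (real n / real (k - 1) ^ 2)"
    unfolding B_def using k by (intro mult_right_mono ln_consecutive_bounds) auto
  ultimately have "real (n - k) * (1 / real (k - 1) ^ 2)
      \<le> 1 / real (k - 2) * (real n / real (k - 1) ^ 2)" by linarith
  then have "real (n - k) / real (k - 1) ^ 2 \<le> (real n / real (k - 2)) / real (k - 1) ^ 2"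
    by (simp only: mult_1_right times_divide_eq_right times_divide_eq_left mult_1_left)
  moreover have "real (k - 1) ^ 2 > 0" "real (k - 2) > 0" using k by simp_all
  ultimately have "real (n - k) * real (k - 2) \<le> real n"
    by (simp only: divide_le_cancel pos_le_divide_eq)
  then have "real ((n - k) * (k - 2)) \<le> real n" by simp
  then show ?thesis by (simp only: of_nat_le_iff)
qed

section \<open>Simple graphs as pairs of sets and their 2-cores\<close>

definition sgraph :: "'a set \<Rightarrow> ('a \<times> 'a) set \<Rightarrow> bool" where
  "sgraph V E \<longleftrightarrow> finite V \<and> E \<subseteq> V \<times> V \<and> sym E \<and> irrefl E"

text \<open>Connectivity is stated through cuts instead of paths because cuts pass easily to images
  under maps and to sets enlarged by one adjacent vertex.\<close>

definition cut_connected :: "'a set \<Rightarrow> ('a \<times> 'a) set \<Rightarrow> bool" where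
  "cut_connected V E \<longleftrightarrow> V \<noteq> {} \<and>
     (\<forall>A\<subseteq>V. A \<noteq> {} \<longrightarrow> A \<noteq> V \<longrightarrow> (\<exists>u\<in>A. \<exists>v\<in>V - A. (u, v) \<in> E))"

abbreviation pgraph :: "'a set \<Rightarrow> ('a \<times> 'a) set \<Rightarrow> ('a, 'a \<times> 'a) pre_digraph" where
  "pgraph V E \<equiv> with_proj \<lparr>pverts = V, parcs = E\<rparr>"

lemma pair_graph_iff_sgraph: "pair_graph \<lparr>pverts = V, parcs = E\<rparr> \<longleftrightarrow> sgraph V E"
proof
  assume "pair_graph \<lparr>pverts = V, parcs = E\<rparr>"
  then interpret pair_graph "\<lparr>pverts = V, parcs = E\<rparr>" .
  show "sgraph V E"
    using pair_finite_verts pair_no_loops arc_fst_in_verts arc_snd_in_verts pair_sym_arcs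
    by (fastforce simp: sgraph_def irrefl_def symmetric_def)
next
  assume V: "sgraph V E"
  then have "finite E" by (auto simp: sgraph_def intro: finite_subset[OF _ finite_cartesian_product])
  with V show "pair_graph \<lparr>pverts = V, parcs = E\<rparr>"
    by unfold_locales (auto simp: sgraph_def irrefl_def symmetric_def)
qed

text \<open>A path from inside \<open>A\<close> to outside must leave \<open>A\<close>. Conversely,
  the set of vertices reachable from \<open>u\<close> has no leaving edge, so it is all of
  \<open>V\<close>.\<close>

lemma connected_iff_cut_connected:
  assumes "sgraph V E"
  shows "connected (pgraph V E) \<longleftrightarrow> cut_connected V E"
proof -
  interpret pair_graph "\<lparr>pverts = V, parcs = E\<rparr>"
    using assms by (simp add: pair_graph_iff_sgraph)
  have conn: "connected (pgraph V E) \<longleftrightarrow> V \<noteq> {} \<and> (\<forall>u\<in>V. \<forall>v\<in>V. u \<rightarrow>\<^sup>*\<^bsub>pgraph V E\<^esub> v)"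
    unfolding connected_def strongly_connected_def
    using reachable_mk_symmetric_eq[OF sym_arcs] by (simp add: mk_symmetric_def)
  show ?thesis
  proof
    assume con: "connected (pgraph V E)"
    show "cut_connected V E"
      unfolding cut_connected_def
    proof (intro conjI allI impI)
      show "V \<noteq> {}" using con conn by simp
      fix A assume A: "A \<subseteq> V" "A \<noteq> {}" "A \<noteq> V"
      then obtain a b where ab: "a \<in> A" "b \<in> V - A" by blast
      show "\<exists>u\<in>A. \<exists>v\<in>V - A. (u, v) \<in> E"
      proof (rule ccontr)
        assume no: "\<not> (\<exists>u\<in>A. \<exists>v\<in>V - A. (u, v) \<in> E)"
        have "a \<rightarrow>\<^sup>*\<^bsub>pgraph V E\<^esub> b" using con conn ab A by blast
        then have "b \<in> A"
        proof (induction rule: reachable_induct)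
          case (step x y)
          then show ?case using no assms by (auto simp: sgraph_def)
        qed (use ab in auto)
        with ab show False by blast
      qed
    qed
  next
    assume cut: "cut_connected V E"
    show "connected (pgraph V E)"
      unfolding conn
    proof (intro conjI ballI)
      show "V \<noteq> {}" using cut by (simp add: cut_connected_def)
      fix u v assume uv: "u \<in> V" "v \<in> V"
      define A where "A = {x \<in> V. u \<rightarrow>\<^sup>*\<^bsub>pgraph V E\<^esub> x}"
      have "A = V"
      proof (rule ccontr)
        assume "A \<noteq> V"
        moreover have "u \<in> A" using uv by (simp add: A_def)
        moreover have "A \<subseteq> V" by (auto simp: A_def)
        ultimately obtain x y where xy: "x \<in> A" "y \<in> V - A" "(x, y) \<in> E"
          using cut unfolding cut_connected_def by (metis empty_iff)
        then have "u \<rightarrow>\<^sup>*\<^bsub>pgraph V E\<^esub> y"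
          unfolding A_def by (auto intro: reachable_adj_trans)
        with xy show False by (auto simp: A_def)
      qed
      with uv show "u \<rightarrow>\<^sup>*\<^bsub>pgraph V E\<^esub> v" by (auto simp: A_def)
    qed
  qed
qed

lemma proper_colorings_pgraph: "proper_colorings (pgraph V E) k = colorings V E k"
  by (simp add: proper_colorings_def colorings_def)

lemma colorings_mono: "j \<le> k \<Longrightarrow> colorings V E j \<subseteq> colorings V E k"
  unfolding colorings_def using PiE_mono[of V "\<lambda>_. {..<j}" "\<lambda>_. {..<k}"] by auto

lemma colorings_nonempty_if_card_le:
  assumes "sgraph V E" "card V \<le> k"
  shows "colorings V E k \<noteq> {}"
proof -
  have "finite V" using assms(1) by (simp add: sgraph_def)
  then obtain h where h: "bij_betw h V {0..<card V}"
    using ex_bij_betw_finite_nat by blast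
  have "restrict h V \<in> colorings V E k"
  proof (rule coloringsI)
    fix v assume "v \<in> V"
    then have "h v < card V" using bij_betwE[OF h] by auto
    then show "restrict h V v < k" using assms(2) \<open>v \<in> V\<close> by simp
  next
    fix u v assume "(u, v) \<in> E"
    then have "u \<in> V" "v \<in> V" "u \<noteq> v" using assms(1) by (auto simp: sgraph_def irrefl_def)
    then show "restrict h V u \<noteq> restrict h V v"
      using inj_onD[OF bij_betw_imp_inj_on[OF h]] by auto
  qed simp
  then show ?thesis by blast
qed

text \<open>\<open>card V\<close> colours always suffice, so the \<open>LEAST\<close> is attained,
  and monotonicity reduces minimality to \<open>k - 1\<close> colours. Positivity of
  \<open>k\<close> keeps \<open>k - 1\<close> from collapsing to \<open>k\<close>.\<close>

lemma chromatic_number_eq_iff: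
  assumes "sgraph V E" "k > 0"
  shows "chromatic_number (pgraph V E) = k \<longleftrightarrow>
     colorings V E k \<noteq> {} \<and> colorings V E (k - 1) = {}"
proof
  assume "chromatic_number (pgraph V E) = k"
  then have k: "(LEAST k. colorings V E k \<noteq> {}) = k"
    by (simp add: chromatic_number_def proper_colorings_pgraph)
  have "colorings V E (card V) \<noteq> {}"
    using colorings_nonempty_if_card_le[OF assms(1)] by simp
  then have "colorings V E (LEAST k. colorings V E k \<noteq> {}) \<noteq> {}" by (rule LeastI)
  moreover have "\<not> colorings V E (k - 1) \<noteq> {}"
    by (rule not_less_Least) (simp add: k assms(2))
  ultimately show "colorings V E k \<noteq> {} \<and> colorings V E (k - 1) = {}"
    by (simp add: k)
next
  assume *: "colorings V E k \<noteq> {} \<and> colorings V E (k - 1) = {}"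
  have "k \<le> j" if "colorings V E j \<noteq> {}" for j
  proof (rule ccontr)
    assume "\<not> k \<le> j"
    then have "j \<le> k - 1" by simp
    from colorings_mono[OF this] that * show False by blast
  qed
  then show "chromatic_number (pgraph V E) = k"
    unfolding chromatic_number_def proper_colorings_pgraph
    using * by (intro Least_equality) auto
qed

section \<open>Graphs whose 2-core is a clique\<close>

text \<open>This is pruning read backwards, so that the 2-core condition admits induction.
  \<open>A\<close> may be empty, since pruning also removes isolated vertices.\<close>

inductive clique_with_trees :: "nat \<Rightarrow> 'a set \<Rightarrow> ('a \<times> 'a) set \<Rightarrow> bool" for k where
  clique: "finite V \<Longrightarrow> card V = k \<Longrightarrow> clique_with_trees k V {(u, v). u \<in> V \<and> v \<in> V \<and> u \<noteq> v}"
| leaf: "clique_with_trees k V E \<Longrightarrow> x \<notin> V \<Longrightarrow> A \<subseteq> V \<Longrightarrow> card A \<le> 1 \<Longrightarrow>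
    clique_with_trees k (insert x V) (E \<union> {x} \<times> A \<union> A \<times> {x})"

lemma clique_with_trees_sgraph: "clique_with_trees k V E \<Longrightarrow> sgraph V E"
  by (induction rule: clique_with_trees.induct) (auto simp: sgraph_def sym_def irrefl_def)

lemma clique_with_trees_image:
  assumes "clique_with_trees k V E" "inj_on h V"
  shows "clique_with_trees k (h ` V) (map_prod h h ` E)"
  using assms
proof (induction rule: clique_with_trees.induct)
  case (clique V)
  have "map_prod h h ` {(u, v). u \<in> V \<and> v \<in> V \<and> u \<noteq> v}
      = {(u, v). u \<in> h ` V \<and> v \<in> h ` V \<and> u \<noteq> v}"
    using clique.prems by (auto simp: image_iff dest: inj_onD)
  then show ?case
    using clique by (auto intro!: clique_with_trees.clique simp: card_image)
next
  case (leaf V E x A)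
  have "map_prod h h ` (E \<union> {x} \<times> A \<union> A \<times> {x})
     = map_prod h h ` E \<union> {h x} \<times> (h ` A) \<union> (h ` A) \<times> {h x}"
    by auto
  moreover have "card (h ` A) \<le> 1"
    using leaf.hyps(3,4) leaf.prems by (subst card_image) (auto intro: inj_on_subset)
  moreover have "h x \<notin> h ` V" using leaf.prems leaf.hyps(2) by auto
  ultimately show ?case
    using clique_with_trees.leaf[of k "h ` V" "map_prod h h ` E" "h x" "h ` A"] leaf by auto
qed

lemma coloring_extend:
  assumes "f \<in> colorings V E k" "E \<subseteq> V \<times> V" "x \<notin> V" "A \<subseteq> V" "c < k" "c \<notin> f ` A"
  shows "f(x := c) \<in> colorings (insert x V) (E \<union> {x} \<times> A \<union> A \<times> {x}) k"
proof (rule coloringsI)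
  fix v assume "v \<in> insert x V"
  then show "(f(x := c)) v < k" using coloringsD(2)[OF assms(1)] assms(5) by auto
next
  fix v assume "v \<notin> insert x V"
  then show "(f(x := c)) v = undefined"
    using PiE_arb[OF coloringsD(1)[OF assms(1)], of v] by auto
next
  fix u v assume "(u, v) \<in> E \<union> {x} \<times> A \<union> A \<times> {x}"
  then consider "(u, v) \<in> E" | "u = x" "v \<in> A" | "u \<in> A" "v = x" by blast
  then show "(f(x := c)) u \<noteq> (f(x := c)) v"
  proof cases
    case 1
    then have "u \<noteq> x" "v \<noteq> x" using assms(2,3) by auto
    then show ?thesis using coloringsD(3)[OF assms(1) 1] by simp
  qed (use assms(3,4,6) in auto)
qed

text \<open>In the clique every colouring separates all vertices. An attached vertex has at most one
  neighbour, so three colours suffice to avoid that neighbour's colour and one further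
  colour.\<close>

lemma clique_with_trees_separating_coloring:
  assumes "clique_with_trees k V E" "k \<ge> 3" "u \<in> V" "w \<in> V" "u \<noteq> w"
  shows "\<exists>f\<in>colorings V E k. f u \<noteq> f w"
proof -
  \<comment> \<open>Existence of a colouring is carried through the induction, as separating the new
    vertex starts from an arbitrary colouring of the old graph.\<close>
  from assms(1,2) have "colorings V E k \<noteq> {} \<and>
      (\<forall>u\<in>V. \<forall>w\<in>V. u \<noteq> w \<longrightarrow> (\<exists>f\<in>colorings V E k. f u \<noteq> f w))"
  proof (induction rule: clique_with_trees.induct)
    case (clique V)
    let ?E = "{(u, v). u \<in> V \<and> v \<in> V \<and> u \<noteq> v}"
    have "sgraph V ?E"
      using clique by (intro clique_with_trees_sgraph clique_with_trees.clique)
    then obtain f where f: "f \<in> colorings V ?E k"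
      using colorings_nonempty_if_card_le[of V ?E k] clique by auto
    then have "f u \<noteq> f w" if "u \<in> V" "w \<in> V" "u \<noteq> w" for u w
      using that coloringsD(3)[OF f, of u w] by auto
    with f show ?case by blast
  next
    case (leaf V E x A)
    let ?E = "E \<union> {x} \<times> A \<union> A \<times> {x}"
    have V: "finite V" "E \<subseteq> V \<times> V"
      using clique_with_trees_sgraph[OF leaf.hyps(1)] by (auto simp: sgraph_def)
    have finA: "finite A" using leaf.hyps(3) V(1) by (rule finite_subset)
    have ext: "\<exists>c. c \<noteq> f w \<and> f(x := c) \<in> colorings (insert x V) ?E k"
      if f: "f \<in> colorings V E k" for f w
    proof -
      have "card (insert (f w) (f ` A)) \<le> Suc (card (f ` A))" by (rule card_insert_le_m1) auto
      also have "\<dots> \<le> 2" using leaf.hyps(4) card_image_le[OF finA, of f] by simp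
      finally have "card (insert (f w) (f ` A)) < card {..<k}" using leaf.prems by simp
      then have "\<not> {..<k} \<subseteq> insert (f w) (f ` A)"
        using finA by (metis card_mono finite.insertI finite_imageI not_le)
      then obtain c where "c < k" "c \<noteq> f w" "c \<notin> f ` A" by auto
      then show ?thesis using coloring_extend[OF f V(2) leaf.hyps(2,3)] by blast
    qed
    have IH: "colorings V E k \<noteq> {}"
      "\<And>u w. u \<in> V \<Longrightarrow> w \<in> V \<Longrightarrow> u \<noteq> w \<Longrightarrow> \<exists>f\<in>colorings V E k. f u \<noteq> f w"
      using leaf.IH leaf.prems by auto
    have x_new: "\<exists>f\<in>colorings (insert x V) ?E k. f x \<noteq> f w" if "w \<in> V" for w
    proof -
      obtain f where "f \<in> colorings V E k" using IH(1) by blast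
      from ext[OF this, of w] obtain c
        where "c \<noteq> f w" "f(x := c) \<in> colorings (insert x V) ?E k" by blast
      moreover have "w \<noteq> x" using that leaf.hyps(2) by blast
      ultimately show ?thesis by (intro bexI[of _ "f(x := c)"]) auto
    qed
    have old: "\<exists>f\<in>colorings (insert x V) ?E k. f u \<noteq> f w"
      if uw: "u \<in> V" "w \<in> V" "u \<noteq> w" for u w
    proof -
      obtain f where f: "f \<in> colorings V E k" "f u \<noteq> f w" using IH(2)[OF uw] by blast
      from ext[OF f(1)] obtain c where "f(x := c) \<in> colorings (insert x V) ?E k" by blast
      moreover have "u \<noteq> x" "w \<noteq> x" using uw leaf.hyps(2) by blast+
      ultimately show ?thesis using f(2) by (intro bexI[of _ "f(x := c)"]) auto
    qed
    have "colorings (insert x V) ?E k \<noteq> {}" using IH(1) ext by blast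
    moreover have "\<exists>f\<in>colorings (insert x V) ?E k. f u \<noteq> f w"
      if "u \<in> insert x V" "w \<in> insert x V" "u \<noteq> w" for u w
      using that x_new[of u] x_new[of w] old[of u w] by (metis insertE)
    ultimately show ?case by blast
  qed
  with assms show ?thesis by blast
qed

lemma del_vert_pgraph:
  "pre_digraph.del_vert (pgraph V E) x = pgraph (V - {x}) {e \<in> E. fst e \<noteq> x \<and> snd e \<noteq> x}"
  by (simp add: pre_digraph.del_vert_def with_proj_def)

lemma out_degree_pgraph: "out_degree (pgraph V E) x = card {y. (x, y) \<in> E}"
proof -
  have "out_arcs (pgraph V E) x = Pair x ` {y. (x, y) \<in> E}"
    by (auto simp: out_arcs_def)
  then show ?thesis by (simp add: out_degree_def card_image inj_on_def)
qed

text \<open>Each pruned vertex is put back as a \<open>leaf\<close>, the last one deleted being the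
  first to return.\<close>

lemma prune_to_clique_imp_clique_with_trees:
  assumes "prune_step\<^sup>*\<^sup>* X C" "complete_digraph k C" "X = pgraph V E" "sgraph V E"
  shows "clique_with_trees k V E"
  using assms(1,3,4)
proof (induction arbitrary: V E rule: converse_rtranclp_induct)
  case base
  have "finite V" using base.prems(2) by (simp add: sgraph_def)
  moreover have "card V = k" "E = {(u, v). u \<in> V \<and> v \<in> V \<and> u \<noteq> v}"
    using assms(2) base.prems(1) by (auto simp: complete_digraph_def)
  ultimately show ?case by (simp add: clique_with_trees.clique)
next
  case (step X Y)
  from step(1) obtain x where x: "x \<in> V" "out_degree (pgraph V E) x \<le> 1"
    and Y: "Y = pre_digraph.del_vert (pgraph V E) x"
    by (auto simp: step.prems(1) elim: prune_step.cases)
  define E' where "E' = {e \<in> E. fst e \<noteq> x \<and> snd e \<noteq> x}"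
  define A where "A = {y. (x, y) \<in> E}"
  have sg: "finite V" "E \<subseteq> V \<times> V" "sym E" "irrefl E"
    using step.prems(2) by (auto simp: sgraph_def)
  have "sgraph (V - {x}) E'" using sg by (fastforce simp: sgraph_def E'_def sym_def irrefl_def)
  then have "clique_with_trees k (V - {x}) E'"
    by (intro step.IH) (auto simp: Y del_vert_pgraph E'_def)
  moreover have "A \<subseteq> V - {x}" using sg by (auto simp: A_def irrefl_def)
  moreover have "card A \<le> 1" using x(2) by (simp add: out_degree_pgraph A_def)
  ultimately have "clique_with_trees k (insert x (V - {x})) (E' \<union> {x} \<times> A \<union> A \<times> {x})"
    by (intro clique_with_trees.leaf) auto
  moreover have "E' \<union> {x} \<times> A \<union> A \<times> {x} = E"
    using sg(3) by (auto simp: E'_def A_def dest: symD)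
  moreover have "insert x (V - {x}) = V" using x(1) by auto
  ultimately show ?case by simp
qed

lemma clique_with_trees_prune:
  assumes "clique_with_trees k V E"
  shows "\<exists>K. finite K \<and> card K = k \<and>
    prune_step\<^sup>*\<^sup>* (pgraph V E) (pgraph K {(u, v). u \<in> K \<and> v \<in> K \<and> u \<noteq> v})"
  using assms
proof (induction rule: clique_with_trees.induct)
  case (clique V)
  then show ?case by blast
next
  case (leaf V E x A)
  let ?E = "E \<union> {x} \<times> A \<union> A \<times> {x}"
  have V: "E \<subseteq> V \<times> V"
    using clique_with_trees_sgraph[OF leaf.hyps(1)] by (auto simp: sgraph_def)
  have "{y. (x, y) \<in> ?E} = A" using V leaf.hyps(2,3) by auto
  then have "out_degree (pgraph (insert x V) ?E) x \<le> 1"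
    using leaf.hyps(4) by (simp add: out_degree_pgraph)
  then have "prune_step (pgraph (insert x V) ?E) (pre_digraph.del_vert (pgraph (insert x V) ?E) x)"
    by (intro prune_step.intros) auto
  moreover have "{e \<in> ?E. fst e \<noteq> x \<and> snd e \<noteq> x} = E" "insert x V - {x} = V"
    using V leaf.hyps(2) by auto
  ultimately have "prune_step (pgraph (insert x V) ?E) (pgraph V E)"
    by (simp add: del_vert_pgraph)
  with leaf.IH show ?case by (blast intro: converse_rtranclp_into_rtranclp)
qed

text \<open>A clique on \<open>k >= 3\<close> vertices has all degrees \<open>k - 1 >= 2\<close>, so
  pruning stops there, and uniqueness of the 2-core identifies it.\<close>

lemma complete_two_core_iff:
  assumes "sgraph V E" "k \<ge> 3"
  shows "complete_digraph k (two_core (pgraph V E)) \<longleftrightarrow> clique_with_trees k V E"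
proof -
  interpret pair_graph "\<lparr>pverts = V, parcs = E\<rparr>"
    using assms by (simp add: pair_graph_iff_sgraph)
  have core: "is_two_core (pgraph V E) (two_core (pgraph V E))"
    unfolding two_core_def by (rule theI'[OF ex1_two_core])
  show ?thesis
  proof
    assume "complete_digraph k (two_core (pgraph V E))"
    with core show "clique_with_trees k V E"
      using prune_to_clique_imp_clique_with_trees[OF _ _ refl assms(1)]
      unfolding is_two_core_def by blast
  next
    assume "clique_with_trees k V E"
    then obtain K where K: "finite K" "card K = k"
      and prune: "prune_step\<^sup>*\<^sup>* (pgraph V E) (pgraph K {(u, v). u \<in> K \<and> v \<in> K \<and> u \<noteq> v})"
      using clique_with_trees_prune by blast
    let ?K = "pgraph K {(u, v). u \<in> K \<and> v \<in> K \<and> u \<noteq> v}"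
    have "\<not> prune_step ?K Y" for Y
    proof
      assume "prune_step ?K Y"
      then obtain x where x: "x \<in> K" "out_degree ?K x \<le> 1" by (auto elim: prune_step.cases)
      have "{y. (x, y) \<in> {(u, v). u \<in> K \<and> v \<in> K \<and> u \<noteq> v}} = K - {x}" using x(1) by auto
      then have "out_degree ?K x = k - 1" using K x(1) by (simp add: out_degree_pgraph)
      with x(2) assms(2) show False by simp
    qed
    with prune have "is_two_core (pgraph V E) ?K" by (auto simp: is_two_core_def)
    with core ex1_two_core have "two_core (pgraph V E) = ?K" by blast
    then show "complete_digraph k (two_core (pgraph V E))"
      using K by (auto simp: complete_digraph_pair_def)
  qed
qed

text \<open>The interface to the given definitions: everything after it works with sets and
  \<open>clique_with_trees\<close>.\<close>

lemma counterexample_iff: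
  assumes "k \<ge> 3"
  shows "counterexample k \<lparr>pverts = V, parcs = E\<rparr> \<longleftrightarrow>
    sgraph V E \<and> cut_connected V E \<and> colorings V E k \<noteq> {} \<and> colorings V E (k - 1) = {} \<and>
    (card (colorings V E k) > fact k * (k - 1) ^ (card V - k) \<or>
     card (colorings V E k) = fact k * (k - 1) ^ (card V - k) \<and> \<not> clique_with_trees k V E)"
proof (cases "sgraph V E")
  case True
  show ?thesis
    unfolding counterexample_def num_colorings_def proper_colorings_pgraph pair_graph_iff_sgraph
      connected_iff_cut_connected[OF True] complete_two_core_iff[OF True assms]
      chromatic_number_eq_iff[OF True, of k]
    using True assms by (auto simp: chromatic_number_eq_iff)
qed (auto simp: counterexample_def pair_graph_iff_sgraph)

section \<open>Minimal counterexamples\<close>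

definition induced_edges :: "('a \<times> 'a) set \<Rightarrow> 'a set \<Rightarrow> ('a \<times> 'a) set" where
  "induced_edges E W = E \<inter> W \<times> W"

lemma induced_edges_self: "sgraph V E \<Longrightarrow> induced_edges E V = E"
  by (auto simp: sgraph_def induced_edges_def)

lemma sgraph_induced: "sgraph V E \<Longrightarrow> W \<subseteq> V \<Longrightarrow> sgraph W (induced_edges E W)"
  by (auto simp: sgraph_def induced_edges_def sym_def irrefl_def intro: finite_subset)

text \<open>Pulling back along \<open>h\<close> is a bijection onto the colourings that are constant
  on the fibres of \<open>h\<close>. If \<open>h\<close> identifies adjacent vertices, the image has
  a loop and both sides are 0.\<close>

lemma card_colorings_image:
  assumes "E \<subseteq> V \<times> V"
  shows "card (colorings (h ` V) (map_prod h h ` E) k)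
       = card {f \<in> colorings V E k. \<forall>u\<in>V. \<forall>w\<in>V. h u = h w \<longrightarrow> f u = f w}" (is "_ = card ?C")
proof -
  let ?C' = "colorings (h ` V) (map_prod h h ` E) k"
  let ?pull = "\<lambda>g. restrict (g \<circ> h) V"
  have inj: "inj_on ?pull ?C'"
  proof (rule inj_onI)
    fix g g' assume g: "g \<in> ?C'" "g' \<in> ?C'" and eq: "?pull g = ?pull g'"
    show "g = g'"
    proof (rule PiE_ext[OF coloringsD(1)[OF g(1)] coloringsD(1)[OF g(2)]])
      fix x assume "x \<in> h ` V"
      then obtain v where "v \<in> V" "x = h v" by blast
      then show "g x = g' x" using fun_cong[OF eq, of v] by simp
    qed
  qed
  have img: "?pull ` ?C' = ?C"
  proof (intro equalityI subsetI)
    fix f assume "f \<in> ?pull ` ?C'"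
    then obtain g where g: "g \<in> ?C'" "f = ?pull g" by blast
    have "f \<in> colorings V E k"
    proof (rule coloringsI)
      fix u v assume uv: "(u, v) \<in> E"
      then have "(h u, h v) \<in> map_prod h h ` E" by force
      from coloringsD(3)[OF g(1) this] uv assms show "f u \<noteq> f v" by (auto simp: g(2))
    qed (use coloringsD(2)[OF g(1)] in \<open>auto simp: g(2)\<close>)
    then show "f \<in> ?C" by (auto simp: g(2))
  next
    fix f assume f: "f \<in> ?C"
    \<comment> \<open>\<open>g\<close> reads \<open>f\<close> at some representative of each fibre;
      constancy of \<open>f\<close> on fibres makes the choice immaterial.\<close>
    define g where "g = restrict (\<lambda>x. f (SOME v. v \<in> V \<and> h v = x)) (h ` V)"
    have gh: "g (h v) = f v" if "v \<in> V" for v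
    proof -
      define w where "w = (SOME u. u \<in> V \<and> h u = h v)"
      have "w \<in> V \<and> h w = h v" unfolding w_def by (rule someI[of _ v]) (simp add: that)
      then have "f w = f v" using f that by blast
      then show ?thesis using that by (simp add: g_def w_def)
    qed
    have fC: "f \<in> colorings V E k" using f by simp
    have "g \<in> ?C'"
    proof (rule coloringsI)
      fix x assume "x \<in> h ` V"
      then show "g x < k" using gh coloringsD(2)[OF fC] by auto
    next
      fix x assume "x \<notin> h ` V"
      then show "g x = undefined" by (simp add: g_def)
    next
      fix x y assume "(x, y) \<in> map_prod h h ` E"
      then obtain u v where "(u, v) \<in> E" "x = h u" "y = h v" by auto
      then show "g x \<noteq> g y" using gh assms coloringsD(3)[OF fC] by (metis SigmaD1 SigmaD2 subsetD)
    qed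
    moreover have "f = ?pull g"
    proof
      fix v show "f v = ?pull g v"
        using gh PiE_arb[OF coloringsD(1)[OF fC], of v] by (cases "v \<in> V") auto
    qed
    ultimately show "f \<in> ?pull ` ?C'" by blast
  qed
  show ?thesis using card_image[OF inj] unfolding img by (rule sym)
qed

text \<open>The preimage of a cut is a cut, and an edge leaving the preimage maps to an edge leaving
  the original cut.\<close>

lemma cut_connected_image:
  assumes "cut_connected V E"
  shows "cut_connected (h ` V) (map_prod h h ` E)"
  unfolding cut_connected_def
proof (intro conjI allI impI)
  show "h ` V \<noteq> {}" using assms by (simp add: cut_connected_def)
  fix A assume A: "A \<subseteq> h ` V" "A \<noteq> {}" "A \<noteq> h ` V"
  define B where "B = {v \<in> V. h v \<in> A}"
  have "B \<subseteq> V" "B \<noteq> {}" "B \<noteq> V" using A by (auto simp: B_def)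
  then obtain u v where uv: "u \<in> B" "v \<in> V - B" "(u, v) \<in> E"
    using assms unfolding cut_connected_def by meson
  then have "h u \<in> A" "h v \<in> h ` V - A" "(h u, h v) \<in> map_prod h h ` E"
    by (auto simp: B_def intro!: image_eqI[of _ _ "(u, v)"])
  then show "\<exists>x\<in>A. \<exists>y\<in>h ` V - A. (x, y) \<in> map_prod h h ` E"
    by (intro bexI[of _ "h u"] bexI[of _ "h v"])
qed

text \<open>\<open>h\<close> both identifies vertices and renames them to natural numbers, over which the minimal
  order of a counterexample is defined.\<close>

lemma smaller_not_counterexample:
  fixes h :: "'a \<Rightarrow> nat"
  assumes k: "k \<ge> 3" and G: "sgraph V E" "cut_connected V E" "colorings V E (k - 1) = {}"
    and less: "card (h ` V) < min_counterexample_order k"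
  defines "C \<equiv> {f \<in> colorings V E k. \<forall>u\<in>V. \<forall>w\<in>V. h u = h w \<longrightarrow> f u = f w}"
  assumes "C \<noteq> {}"
  shows "card C \<le> fact k * (k - 1) ^ (card (h ` V) - k)"
    and "card C = fact k * (k - 1) ^ (card (h ` V) - k)
      \<Longrightarrow> clique_with_trees k (h ` V) (map_prod h h ` E)"
proof -
  let ?V = "h ` V" and ?E = "map_prod h h ` E"
  have V: "finite V" "E \<subseteq> V \<times> V" "sym E" using G(1) by (auto simp: sgraph_def)
  have card: "card (colorings ?V ?E k) = card C"
    unfolding C_def by (rule card_colorings_image[OF V(2)])
  obtain f where f: "f \<in> colorings V E k" "\<And>u w. u \<in> V \<Longrightarrow> w \<in> V \<Longrightarrow> h u = h w \<Longrightarrow> f u = f w"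
    using \<open>C \<noteq> {}\<close> by (auto simp: C_def)
  \<comment> \<open>A colouring that is constant on fibres rules out edges inside a fibre, so the
    image has no loops.\<close>
  have "h u \<noteq> h v" if "(u, v) \<in> E" for u v
    using that coloringsD(3)[OF f(1) that] f(2)[of u v] V(2) by auto
  then have sg: "sgraph ?V ?E"
    using V by (fastforce simp: sgraph_def sym_def irrefl_def)
  have "finite C" unfolding C_def using finite_colorings[OF V(1)] by simp
  then have "card C \<noteq> 0" using \<open>C \<noteq> {}\<close> by simp
  then have some: "colorings ?V ?E k \<noteq> {}" using card by force
  have none: "colorings ?V ?E (k - 1) = {}"
  proof -
    have "card (colorings ?V ?E (k - 1)) = 0"
      unfolding card_colorings_image[OF V(2)] using G(3) by simp
    then show ?thesis using finite_colorings[of ?V] V(1) by simp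
  qed
  have "\<not> counterexample k \<lparr>pverts = ?V, parcs = ?E\<rparr>"
  proof
    assume "counterexample k \<lparr>pverts = ?V, parcs = ?E\<rparr>"
    then have "\<exists>H :: nat pair_pre_digraph. counterexample k H \<and> card (pverts H) = card ?V"
      by (intro exI[of _ "\<lparr>pverts = ?V, parcs = ?E\<rparr>"]) simp
    then have "min_counterexample_order k \<le> card ?V"
      unfolding min_counterexample_order_def by (rule Least_le)
    with less show False by simp
  qed
  then have *: "\<not> (card C > fact k * (k - 1) ^ (card ?V - k) \<or>
      card C = fact k * (k - 1) ^ (card ?V - k) \<and> \<not> clique_with_trees k ?V ?E)"
    using sg cut_connected_image[OF G(2), of h] some none
    unfolding counterexample_iff[OF k] card by blast
  then show "card C \<le> fact k * (k - 1) ^ (card ?V - k)"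
    and "card C = fact k * (k - 1) ^ (card ?V - k) \<Longrightarrow> clique_with_trees k ?V ?E"
    by auto
qed

text \<open>An injective \<open>h\<close> imposes no condition on colourings, and the clique
  structure is carried back by the inverse of \<open>h\<close>.\<close>

lemma smaller_not_counterexample_inj:
  fixes V :: "'a set"
  assumes k: "k \<ge> 3" and G: "sgraph V E" "cut_connected V E" "colorings V E (k - 1) = {}"
    and less: "card V < min_counterexample_order k" and "colorings V E k \<noteq> {}"
  shows "card (colorings V E k) \<le> fact k * (k - 1) ^ (card V - k)"
    and "card (colorings V E k) = fact k * (k - 1) ^ (card V - k) \<Longrightarrow> clique_with_trees k V E"
proof -
  have V: "finite V" "E \<subseteq> V \<times> V" using G(1) by (auto simp: sgraph_def)
  obtain h :: "'a \<Rightarrow> nat" where h: "inj_on h V"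
    using finite_imp_inj_to_nat_seg[OF V(1)] by auto
  have card: "card (h ` V) = card V" by (rule card_image[OF h])
  have all: "{f \<in> colorings V E k. \<forall>u\<in>V. \<forall>w\<in>V. h u = h w \<longrightarrow> f u = f w} = colorings V E k"
    using h by (auto dest: inj_onD)
  note * = smaller_not_counterexample[OF k G, of h, unfolded all card, OF less \<open>colorings V E k \<noteq> {}\<close>]
  show "card (colorings V E k) \<le> fact k * (k - 1) ^ (card V - k)" by (rule *(1))
  assume "card (colorings V E k) = fact k * (k - 1) ^ (card V - k)"
  from *(2)[OF this] have "clique_with_trees k (h ` V) (map_prod h h ` E)" .
  then have "clique_with_trees k (inv_into V h ` h ` V)
      (map_prod (inv_into V h) (inv_into V h) ` map_prod h h ` E)"
    by (rule clique_with_trees_image) (rule inj_on_inv_into[OF subset_refl])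
  moreover have "inv_into V h ` h ` V = V" using h by (rule inv_into_image_cancel) simp
  moreover have "map_prod (inv_into V h) (inv_into V h) ` map_prod h h ` E = id ` E"
    unfolding image_image using V(2) h by (intro image_cong) auto
  ultimately show "clique_with_trees k V E" by simp
qed

section \<open>Structure of a counterexample of minimum order\<close>

locale minimal_counterexample =
  fixes V :: "'a set" and E :: "('a \<times> 'a) set" and k :: nat
  assumes k: "k \<ge> 4"
    and sgraph: "sgraph V E"
    and conn: "cut_connected V E"
    and colorable: "colorings V E k \<noteq> {}"
    and not_colorable: "colorings V E (k - 1) = {}"
    and exceeds: "card (colorings V E k) > fact k * (k - 1) ^ (card V - k) \<or>
      card (colorings V E k) = fact k * (k - 1) ^ (card V - k) \<and> \<not> clique_with_trees k V E"
    and minimal: "card V = min_counterexample_order k"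
begin

lemma V_E: "finite V" "E \<subseteq> V \<times> V" "sym E" "irrefl E"
  using sgraph by (auto simp: sgraph_def)

lemma colorings_remove_vertex:
  assumes "v \<in> V" "f \<in> colorings V E k"
  shows "restrict f (V - {v}) \<in> colorings (V - {v}) (induced_edges E (V - {v})) k"
  using coloringsD[OF assms(2)] by (intro coloringsI) (auto simp: induced_edges_def)

lemma card_ge_if_not_colorable:
  assumes "W \<subseteq> V" "colorings W (induced_edges E W) (k - 1) = {}"
  shows "card W \<ge> k"
  using colorings_nonempty_if_card_le[OF sgraph_induced[OF sgraph assms(1)], of "k - 1"] assms(2)
  by force

text \<open>Otherwise minimality allows at most \<open>T\<close> colourings without
  \<open>v\<close>, each extending in at most \<open>k - 1\<close> ways. Being a counterexample
  forces equality throughout: the rest is a clique with trees, and every colouring of it is constant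
  on the neighbours of \<open>v\<close>. Both outcomes for the degree of \<open>v\<close> are then
  impossible.\<close>

lemma no_deletable_vertex:
  assumes v: "v \<in> V" and conn': "cut_connected (V - {v}) (induced_edges E (V - {v}))"
  shows "colorings (V - {v}) (induced_edges E (V - {v})) (k - 1) \<noteq> {}"
proof
  let ?V = "V - {v}" and ?E = "induced_edges E (V - {v})"
  let ?C = "colorings ?V ?E k"
  assume none: "colorings ?V ?E (k - 1) = {}"
  define A where "A = {u. (v, u) \<in> E}"
  have A: "A \<subseteq> ?V" "finite A"
    using V_E by (auto simp: A_def irrefl_def intro: finite_subset[of _ V])
  have sg: "sgraph ?V ?E" by (rule sgraph_induced[OF sgraph]) auto
  have finC: "finite ?C" by (rule finite_colorings) (simp add: V_E(1))
  have E_eq: "?E \<union> {v} \<times> A \<union> A \<times> {v} = E"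
    using V_E(2,3) by (auto simp: A_def induced_edges_def dest: symD)
  have V_eq: "insert v ?V = V" using v by auto
  have "A \<noteq> {}"
  proof -
    have "{v} \<noteq> V" using conn' by (auto simp: cut_connected_def)
    then show ?thesis using conn v unfolding cut_connected_def A_def by blast
  qed
  have some: "?C \<noteq> {}" using colorable colorings_remove_vertex[OF v] by blast
  have cardV: "card ?V = card V - 1" "card V > 0" using v V_E(1) by (auto simp: card_gt_0_iff)
  \<comment> \<open>Needed so that removing \<open>v\<close> really lowers the truncated exponent by
    one.\<close>
  have k_le: "k \<le> card ?V" by (rule card_ge_if_not_colorable[OF _ none]) auto
  define T where "T = fact k * (k - 1) ^ (card ?V - k)"
  have T: "fact k * (k - 1) ^ (card V - k) = (k - 1) * T"
  proof -
    have "card V - k = Suc (card ?V - k)" using k_le cardV by linarith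
    then show ?thesis by (simp add: T_def)
  qed
  have less: "card ?V < min_counterexample_order k" using cardV minimal by simp
  have k3: "k \<ge> 3" using k by simp
  have bound: "card ?C \<le> T" and clique: "card ?C = T \<Longrightarrow> clique_with_trees k ?V ?E"
    unfolding T_def
    using smaller_not_counterexample_inj[OF k3 sg conn' none less some] by auto
  define s where "s g = card ({..<k} - g ` A)" for g :: "'a \<Rightarrow> nat"
  have s: "s g = k - card (g ` A)" "card (g ` A) > 0" if "g \<in> ?C" for g
  proof -
    have "g ` A \<subseteq> {..<k}" using coloringsD(2)[OF that] A(1) by auto
    then show "s g = k - card (g ` A)" unfolding s_def using A(2) by (subst card_Diff_subset) auto
    show "card (g ` A) > 0" using A(2) \<open>A \<noteq> {}\<close> by (simp add: card_gt_0_iff)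
  qed
  have "card (colorings V E k) \<le> card (Sigma ?C (\<lambda>g. {..<k} - g ` A))"
  proof (rule card_inj_on_le[where f = "\<lambda>f. (restrict f ?V, f v)"])
    show "inj_on (\<lambda>f. (restrict f ?V, f v)) (colorings V E k)"
    proof (rule inj_onI)
      fix f g assume fg: "f \<in> colorings V E k" "g \<in> colorings V E k"
        and eq: "(restrict f ?V, f v) = (restrict g ?V, g v)"
      show "f = g"
      proof (rule PiE_ext[OF coloringsD(1)[OF fg(1)] coloringsD(1)[OF fg(2)]])
        fix u assume "u \<in> V"
        with eq show "f u = g u" by (cases "u = v") (auto dest: fun_cong[of _ _ u])
      qed
    qed
    show "(\<lambda>f. (restrict f ?V, f v)) ` colorings V E k \<subseteq> Sigma ?C (\<lambda>g. {..<k} - g ` A)"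
    proof (rule image_subsetI)
      fix f assume f: "f \<in> colorings V E k"
      have "f v \<noteq> f u" if "u \<in> A" for u
        using coloringsD(3)[OF f] that by (auto simp: A_def)
      then have "f v \<notin> restrict f ?V ` A" using A(1) by auto
      then show "(restrict f ?V, f v) \<in> Sigma ?C (\<lambda>g. {..<k} - g ` A)"
        using colorings_remove_vertex[OF v f] coloringsD(2)[OF f v] by simp
    qed
  qed (use finC in simp)
  then have le_sum: "card (colorings V E k) \<le> (\<Sum>g\<in>?C. s g)"
    using finC by (simp add: s_def)
  have s_le: "s g \<le> k - 1" if "g \<in> ?C" for g using s[OF that] by linarith
  have sum_le: "(\<Sum>g\<in>?C. s g) \<le> card ?C * (k - 1)"
    using sum_bounded_above[of ?C s "k - 1"] s_le by simp
  have "card ?C * (k - 1) \<le> (k - 1) * T" using bound by (simp add: mult.commute)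
  \<comment> \<open>The upper bound \<open>(k - 1) * T\<close> excludes the strict alternative in
    \<open>exceeds\<close>.\<close>
  then have eq: "card (colorings V E k) = (k - 1) * T" "\<not> clique_with_trees k V E"
    using exceeds le_sum sum_le unfolding T by linarith+
  have "T \<le> card ?C"
  proof (rule ccontr)
    assume "\<not> T \<le> card ?C"
    then have "card ?C * (k - 1) < T * (k - 1)" using k by simp
    moreover have "T * (k - 1) \<le> card ?C * (k - 1)"
      using le_trans[OF le_sum sum_le] unfolding eq(1) by (simp only: mult.commute)
    ultimately show False by simp
  qed
  with bound have cardC: "card ?C = T" by simp
  have clq: "clique_with_trees k ?V ?E" by (rule clique[OF cardC])
  show False
  proof (cases "card A \<le> 1")
    case True
    \<comment> \<open>With at most one neighbour, \<open>v\<close> is one more leaf, against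
      \<open>eq(2)\<close>.\<close>
    have "clique_with_trees k (insert v ?V) (?E \<union> {v} \<times> A \<union> A \<times> {v})"
      using clq A(1) True by (intro clique_with_trees.leaf) auto
    then show False using eq(2) unfolding E_eq V_eq by simp
  next
    case False
    then have "\<exists>a b. a \<in> A \<and> b \<in> A \<and> a \<noteq> b"
      using card_le_Suc0_iff_eq[OF A(2)] by auto
    then obtain a b where ab: "a \<in> A" "b \<in> A" "a \<noteq> b" by blast
    \<comment> \<open>A colouring that separates two neighbours of \<open>v\<close> extends in fewer
      than \<open>k - 1\<close> ways and so spoils the equality.\<close>
    then obtain g where g: "g \<in> ?C" "g a \<noteq> g b"
      using clique_with_trees_separating_coloring[OF clq k3] A(1) by blast
    have "card {g a, g b} \<le> card (g ` A)" using ab A(2) by (intro card_mono) auto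
    then have "card (g ` A) \<ge> 2" using g(2) by simp
    then have "s g < k - 1" using s[OF g(1)] k by linarith
    then have "(\<Sum>g\<in>?C. s g) < (\<Sum>g\<in>?C. k - 1)"
      using s_le g(1) finC by (intro sum_strict_mono_ex1) auto
    then show False using le_sum eq(1) cardC by (simp add: mult.commute)
  qed
qed

lemma cut_connected_insert:
  assumes W: "cut_connected W (induced_edges E W)" and x: "w \<in> W" "(w, x) \<in> E"
  shows "cut_connected (insert x W) (induced_edges E (insert x W))"
  unfolding cut_connected_def
proof (intro conjI allI impI)
  show "insert x W \<noteq> {}" by simp
  fix A assume A: "A \<subseteq> insert x W" "A \<noteq> {}" "A \<noteq> insert x W"
  have xw: "(x, w) \<in> E" using x(2) V_E(3) by (auto dest: symD)
  show "\<exists>u\<in>A. \<exists>v\<in>insert x W - A. (u, v) \<in> induced_edges E (insert x W)"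
  proof (cases "A \<inter> W = {} \<or> A \<inter> W = W")
    case False
    then obtain u v where "u \<in> A \<inter> W" "v \<in> W - A \<inter> W" "(u, v) \<in> induced_edges E W"
      using W unfolding cut_connected_def by (metis inf_le2)
    then show ?thesis by (auto simp: induced_edges_def)
  next
    case True
    then show ?thesis
    proof
      assume "A \<inter> W = {}"
      then have "x \<in> A" "w \<notin> A" using A x(1) by auto
      then show ?thesis
        using xw x(1) by (intro bexI[of _ x] bexI[of _ w]) (auto simp: induced_edges_def)
    next
      assume "A \<inter> W = W"
      then have "x \<notin> A" "w \<in> A" using A x(1) by auto
      then show ?thesis
        using x by (intro bexI[of _ w] bexI[of _ x]) (auto simp: induced_edges_def)
    qed
  qed
qed

section \<open>Vertex-criticality and minimum degree\<close>

lemma not_colorable_superset: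
  assumes "W \<subseteq> W'" "colorings W (induced_edges E W) j = {}"
  shows "colorings W' (induced_edges E W') j = {}"
proof (rule ccontr)
  assume "colorings W' (induced_edges E W') j \<noteq> {}"
  then obtain f where f: "f \<in> colorings W' (induced_edges E W') j" by blast
  have "restrict f W \<in> colorings W (induced_edges E W) j"
  proof (rule coloringsI)
    fix u v assume "(u, v) \<in> induced_edges E W"
    then show "restrict f W u \<noteq> restrict f W v"
      using coloringsD(3)[OF f, of u v] assms(1) by (auto simp: induced_edges_def)
  qed (use coloringsD(2)[OF f] assms(1) in auto)
  with assms(2) show False by blast
qed

text \<open>Adding adjacent vertices one at a time keeps the set connected and not colourable with
  \<open>k - 1\<close> colours. The last set before \<open>V\<close> omits a single vertex and
  contradicts \<open>no_deletable_vertex\<close>.\<close>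

lemma no_proper_subgraph:
  assumes "W \<subset> V" "cut_connected W (induced_edges E W)"
  shows "colorings W (induced_edges E W) (k - 1) \<noteq> {}"
  using assms
proof (induction "card (V - W)" arbitrary: W rule: less_induct)
  case less
  have "W \<noteq> {}" using less.prems(2) by (simp add: cut_connected_def)
  then obtain w x where wx: "w \<in> W" "x \<in> V - W" "(w, x) \<in> E"
    using conn less.prems(1) unfolding cut_connected_def by (metis psubset_imp_subset psubsetE order_refl)
  have conn': "cut_connected (insert x W) (induced_edges E (insert x W))"
    by (rule cut_connected_insert[OF less.prems(2) wx(1,3)])
  have "colorings (insert x W) (induced_edges E (insert x W)) (k - 1) \<noteq> {}
    \<or> (insert x W = V)"
  proof (cases "insert x W = V")
    case False
    have "card (V - insert x W) < card (V - W)"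
      using wx(2) V_E(1) by (intro psubset_card_mono) auto
    then show ?thesis using less.hyps[OF _ _ conn'] less.prems(1) wx(2) False by blast
  qed simp
  then show ?case
  proof
    assume "colorings (insert x W) (induced_edges E (insert x W)) (k - 1) \<noteq> {}"
    then show ?thesis using not_colorable_superset[of W "insert x W" "k - 1"] by blast
  next
    assume "insert x W = V"
    then have "W = V - {x}" using wx(2) by auto
    then show ?thesis using no_deletable_vertex[of x] less.prems(2) wx(2) by simp
  qed
qed

text \<open>If no edge crossed from \<open>A\<close> to \<open>W - A\<close>, colourings of the two
  smaller parts would combine to one of \<open>W\<close>.\<close>

lemma cut_connected_if_minimal_not_colorable:
  assumes W: "W \<subseteq> V" "colorings W (induced_edges E W) j = {}"
    and min: "\<And>W'. W' \<subset> W \<Longrightarrow> colorings W' (induced_edges E W') j \<noteq> {}"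
  shows "cut_connected W (induced_edges E W)"
  unfolding cut_connected_def
proof (intro conjI allI impI)
  show "W \<noteq> {}"
  proof
    assume "W = {}"
    then have "(\<lambda>_. undefined) \<in> colorings W (induced_edges E W) j"
      by (intro coloringsI) (auto simp: induced_edges_def)
    with W(2) show False by blast
  qed
  fix A assume A: "A \<subseteq> W" "A \<noteq> {}" "A \<noteq> W"
  show "\<exists>u\<in>A. \<exists>v\<in>W - A. (u, v) \<in> induced_edges E W"
  proof (rule ccontr)
    assume no: "\<not> (\<exists>u\<in>A. \<exists>v\<in>W - A. (u, v) \<in> induced_edges E W)"
    have "A \<subset> W" "W - A \<subset> W" using A by auto
    from this[THEN min] obtain f g where f: "f \<in> colorings A (induced_edges E A) j"
      and g: "g \<in> colorings (W - A) (induced_edges E (W - A)) j" by blast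
    define c where "c = restrict (\<lambda>x. if x \<in> A then f x else g x) W"
    have "c \<in> colorings W (induced_edges E W) j"
    proof (rule coloringsI)
      fix u v assume uv: "(u, v) \<in> induced_edges E W"
      then have vu: "(v, u) \<in> induced_edges E W" "u \<in> W" "v \<in> W"
        using V_E(3) by (auto simp: induced_edges_def dest: symD)
      have "u \<in> A \<longleftrightarrow> v \<in> A" using no uv vu by blast
      then show "c u \<noteq> c v"
        using uv coloringsD(3)[OF f, of u v] coloringsD(3)[OF g, of u v]
        by (auto simp: c_def induced_edges_def)
    qed (use coloringsD(2)[OF f] coloringsD(2)[OF g] in \<open>auto simp: c_def\<close>)
    with W(2) show False by blast
  qed
qed

text \<open>A smallest vertex set that is not colourable with \<open>k - 1\<close> colours is
  connected, hence equals \<open>V\<close>. So deleting \<open>v\<close> leaves a graph with such a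
  colouring, which would extend to \<open>v\<close> if its neighbours did not use all
  \<open>k - 1\<close> colours.\<close>

lemma degree_ge:
  assumes v: "v \<in> V"
  shows "card {u. (u, v) \<in> E} \<ge> k - 1"
proof -
  let ?P = "\<lambda>W. W \<subseteq> V \<and> colorings W (induced_edges E W) (k - 1) = {}"
  have "?P V" using not_colorable induced_edges_self[OF sgraph] by simp
  then obtain W where W: "?P W" and least: "\<And>W'. ?P W' \<Longrightarrow> card W \<le> card W'"
    using ex_has_least_nat[of ?P V card] by blast
  have min: "colorings W' (induced_edges E W') (k - 1) \<noteq> {}" if "W' \<subset> W" for W'
  proof
    assume "colorings W' (induced_edges E W') (k - 1) = {}"
    then have "card W \<le> card W'" using least[of W'] that W by auto
    moreover have "card W' < card W"
      using that W V_E(1) by (intro psubset_card_mono) (auto intro: finite_subset)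
    ultimately show False by simp
  qed
  have "cut_connected W (induced_edges E W)"
    using W min by (intro cut_connected_if_minimal_not_colorable) auto
  then have "W = V" using no_proper_subgraph[of W] W by blast
  then obtain f where f: "f \<in> colorings (V - {v}) (induced_edges E (V - {v})) (k - 1)"
    using min[of "V - {v}"] v by blast
  define A where "A = {u. (u, v) \<in> E}"
  have A: "A \<subseteq> V - {v}" "finite A"
    using V_E by (auto simp: A_def irrefl_def intro: finite_subset[of _ V])
  have E_eq: "induced_edges E (V - {v}) \<union> {v} \<times> A \<union> A \<times> {v} = E"
    using V_E(2,3) by (auto simp: A_def induced_edges_def dest: symD)
  show ?thesis
  proof (rule ccontr)
    assume "\<not> k - 1 \<le> card {u. (u, v) \<in> E}"
    then have "card (f ` A) < card {..<k - 1}"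
      using card_image_le[OF A(2), of f] by (simp add: A_def)
    then have "\<not> {..<k - 1} \<subseteq> f ` A"
      using A(2) by (metis card_mono finite_imageI not_le)
    then obtain c where "c < k - 1" "c \<notin> f ` A" by blast
    then have "f(v := c) \<in> colorings (insert v (V - {v})) E (k - 1)"
      using coloring_extend[OF f _ _ A(1), of v c] unfolding E_eq by (auto simp: induced_edges_def)
    moreover have "insert v (V - {v}) = V" using v by auto
    ultimately show False using not_colorable by simp
  qed
qed

lemma card_colorings_ge: "card (colorings V E k) \<ge> fact k * (k - 1) ^ (card V - k)"
  using exceeds by linarith

text \<open>Colourings that are monochromatic on \<open>N\<close> are colourings of the graph with
  \<open>N\<close> contracted to one vertex. It has two vertices fewer, so minimality bounds their
  number, and the missing factor \<open>(k - 1) ^ 2\<close> is recovered from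
  \<open>card_colorings_ge\<close>.\<close>

lemma card_monochromatic_triple:
  assumes N: "N \<subseteq> V" "card N = 3" and n: "card V \<ge> k + 2"
  shows "card {f \<in> colorings V E k. card (f ` N) = 1} * (k - 1) ^ 2 \<le> card (colorings V E k)"
proof -
  have finN: "finite N" using N(2) card_ge_0_finite by force
  obtain s where s: "s \<in> N" using N(2) by fastforce
  obtain e :: "'a \<Rightarrow> nat" where e: "inj_on e V"
    using finite_imp_inj_to_nat_seg[OF V_E(1)] by auto
  \<comment> \<open>All of \<open>N\<close> is sent to its member \<open>s\<close>; \<open>e\<close>
    only renames vertices to natural numbers.\<close>
  define \<phi> where "\<phi> u = e (if u \<in> N then s else u)" for u
  have "\<phi> ` V = e ` (V - (N - {s}))"
    using s N(1) by (force simp: \<phi>_def image_iff)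
  then have "card (\<phi> ` V) = card (V - (N - {s}))"
    using e by (simp add: card_image inj_on_diff)
  also have "\<dots> = card V - 2"
    using N finN s by (subst card_Diff_subset) auto
  finally have card: "card (\<phi> ` V) = card V - 2" .
  have eq: "{f \<in> colorings V E k. card (f ` N) = 1}
     = {f \<in> colorings V E k. \<forall>u\<in>V. \<forall>w\<in>V. \<phi> u = \<phi> w \<longrightarrow> f u = f w}" (is "?M = ?M'")
  proof (rule Collect_cong, rule conj_cong[OF refl])
    fix f :: "'a \<Rightarrow> nat"
    have \<phi>: "\<phi> u = \<phi> w \<longleftrightarrow> u = w \<or> u \<in> N \<and> w \<in> N" if "u \<in> V" "w \<in> V" for u w
      using that s N(1) inj_on_eq_iff[OF e] by (auto simp: \<phi>_def)
    have "card (f ` N) = 1 \<longleftrightarrow> (\<forall>u\<in>N. \<forall>w\<in>N. f u = f w)"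
    proof
      assume "card (f ` N) = 1"
      then obtain c where "f ` N = {c}" by (rule card_1_singletonE)
      then show "\<forall>u\<in>N. \<forall>w\<in>N. f u = f w" by (metis imageI singletonD)
    next
      assume "\<forall>u\<in>N. \<forall>w\<in>N. f u = f w"
      then have "f ` N = (\<lambda>_. f s) ` N" using s by (intro image_cong refl) blast
      also have "\<dots> = {f s}" using s by (rule image_constant)
      finally show "card (f ` N) = 1" by simp
    qed
    then show "card (f ` N) = 1 \<longleftrightarrow> (\<forall>u\<in>V. \<forall>w\<in>V. \<phi> u = \<phi> w \<longrightarrow> f u = f w)"
      using \<phi> N(1) by blast
  qed
  show ?thesis
  proof (cases "?M' = {}")
    case False
    have "card (\<phi> ` V) < min_counterexample_order k" using card minimal n by simp
    moreover have "k \<ge> 3" using k by simp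
    ultimately have "card ?M \<le> fact k * (k - 1) ^ (card V - 2 - k)"
      using smaller_not_counterexample(1)[OF _ sgraph conn not_colorable _ False]
      unfolding eq card by blast
    then have "card ?M * (k - 1) ^ 2 \<le> fact k * (k - 1) ^ (card V - 2 - k) * (k - 1) ^ 2"
      by (rule mult_right_mono) simp
    also have "\<dots> = fact k * (k - 1) ^ (card V - 2 - k + 2)"
      by (simp only: power_add mult.assoc)
    \<comment> \<open>The assumption \<open>card V >= k + 2\<close> makes the truncated subtractions
      exact.\<close>
    also have "card V - 2 - k + 2 = card V - k" using n by simp
    also note card_colorings_ge
    finally show ?thesis .
  next
    case True
    show ?thesis unfolding eq True by simp
  qed
qed

text \<open>By \<open>degree_ge\<close> and \<open>k >= 4\<close> every vertex has at least three
  neighbours, so a triple can be fixed for each vertex independently of the colouring.\<close>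

lemma order_bound:
  assumes n: "card V \<ge> k + 2"
  shows "(card V - k) * (k - 2) \<le> card V"
proof -
  have "\<exists>N. N \<subseteq> V \<and> card N = 3 \<and> (\<forall>u\<in>N. (u, v) \<in> E)" if "v \<in> V" for v
  proof -
    have "3 \<le> card {u. (u, v) \<in> E}" using degree_ge[OF that] k by linarith
    then obtain N where "N \<subseteq> {u. (u, v) \<in> E}" "card N = 3"
      using obtain_subset_with_card_n by metis
    then show ?thesis using V_E(2) by blast
  qed
  then obtain N where N: "\<And>v. v \<in> V \<Longrightarrow> N v \<subseteq> V \<and> card (N v) = 3 \<and> (\<forall>u\<in>N v. (u, v) \<in> E)"
    by metis
  show ?thesis
  proof (rule few_vertices_if_many_colorings[OF V_E k not_colorable card_colorings_ge N])
    fix v assume "v \<in> V"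
    from N[OF this] show "card {f \<in> colorings V E k. card (f ` N v) = 1} * (k - 1) ^ 2
        \<le> card (colorings V E k)"
      by (intro card_monochromatic_triple n) auto
  qed
qed

end

theorem theorem10:
  fixes k n :: nat and G :: "'a pair_pre_digraph"
  assumes "k \<ge> 4"
    and "\<exists>H :: nat pair_pre_digraph. counterexample k H"
    and "bad k G" and "card (pverts G) = n"
  shows "(k = 4 \<and> n \<le> 12) \<or> (k \<ge> 5 \<and> n \<le> 2 * k - 2)"
proof (rule ccontr)
  assume neg: "\<not> ?thesis"
  have G: "counterexample k \<lparr>pverts = pverts G, parcs = parcs G\<rparr>"
    "card (pverts G) = min_counterexample_order k"
    using assms(3) by (cases G, simp add: bad_def)+
  interpret minimal_counterexample "pverts G" "parcs G" k
    using G assms(1) counterexample_iff[of k "pverts G" "parcs G"] by unfold_locales auto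
  have cases: "k = 4 \<and> n \<ge> 13 \<or> k \<ge> 5 \<and> n \<ge> 2 * k - 1" using neg assms(1) by auto
  \<comment> \<open>In both cases \<open>n >= k + 2\<close>, as \<open>order_bound\<close> requires.
    For \<open>k = 4\<close> the result reads \<open>2 * (n - 4) <= n\<close>, so even
    \<open>n <= 8\<close>.\<close>
  then have "(n - k) * (k - 2) \<le> n" using order_bound assms(4) by auto
  with cases show False
  proof (elim disjE)
    assume "k \<ge> 5 \<and> n \<ge> 2 * k - 1"
    \<comment> \<open>Lowering the factor \<open>k - 2\<close> to 3 keeps the arithmetic linear:
      \<open>3 * (n - k) <= n\<close> already contradicts \<open>n >= 2 * k - 1\<close>.\<close>
    moreover from this have "(n - k) * 3 \<le> (n - k) * (k - 2)" by (intro mult_left_mono) auto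
    ultimately show False using \<open>(n - k) * (k - 2) \<le> n\<close> by linarith
  qed auto
qed

end
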